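(* Let $m,n,b$ be positive integers with $m\ge n$, let $\lambda=(m,n^b)$, and let $\mu=(\mu_1,\ldots,\mu_{b+2})$ be a tuple of nonnegative integers with $\sum_{i=1}^{b+2}\mu_i=m+nb$. Let $C=\mathbb{Z}/(b+1)\mathbb{Z}$ act on $SSYT(\lambda,\mu)$ with the generator $1$ acting as $\partial^{b+2}$, where $\partial$ is jeu-de-taquin promotion, and let $$f(q)=\left[\begin{array}{c} b+\beta(\lambda,\mu)\\ \beta(\lambda,\mu)\end{array}\right]_q .$$ Then $(SSYT(\lambda,\mu),C,f(q))$ exhibits the cyclic sieving phenomenon; that is, for every integer $d\ge 0$, the number of $T\in SSYT(\lambda,\mu)$ with $\partial^{(b+2)d}(T)=T$ equals $f(\omega^d)$, where $\omega$ is a primitive $(b+1)$-th root of unity.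
   Context: Partition $(m,n^b)$: one part equal to $m$ followed by $b$ parts equal to $n$. $SSYT(\lambda,\mu)$ is the set of semistandard Young tableaux (English notation, rows weakly increasing left to right, columns strictly increasing top to bottom) of shape $\lambda$ with entries in $\{1,\ldots,b+2\}$ and content $\mu$, i.e. with exactly $\mu_i$ entries equal to $i$. Definition of $\beta$: $\beta(\lambda,\mu)=m-n-\sum_{i=1}^{b+2}\gamma_i$, where $\gamma_i=\mu_i-n$ if $\mu_i>n$ and $\gamma_i=0$ otherwise. Jeu-de-taquin promotion $\partial$: let $T$ be a semistandard tableau with entries in $\{1,\ldots,k\}$ (here $k=b+2$). Replace each entry equal to $k$ by a dot. While some dot is not in the continuous strip of dots in the northwest corner, choose the westernmost such dot and slide it north or west until it joins the connected component of dots in the northwest corner, by the following rules. If the dot has entry $b'$ directly above it and entry $c$ directly to its left, it is exchanged with $b'$ if $c\le b'$, and with $c$ if $b'<c$. If only one of these two neighbours is present (a box outside the diagram, or one already occupied by a dot of the northwest component, is regarded as absent), the dot is exchanged with that one. When all dots are in the northwest component, replace every dot by $1$ and increase every other entry by one. The result $\partial(T)$ is a semistandard tableau of the same shape; if $T$ has content $(\mu_1,\ldots,\mu_k)$ then $\partial(T)$ has content $(\mu_k,\mu_1,\ldots,\mu_{k-1})$. Hence $\partial^{b+2}$ maps $SSYT(\lambda,\mu)$ to itself. $q$-binomial coefficients: $[N]_q=\frac{q^N-1}{q-1}$, $[N]_q!=[N]_q[N-1]_q\cdots[1]_q$, and $\left[\begin{array}{c}N\\k\end{array}\right]_q=\frac{[N]_q!}{[k]_q![N-k]_q!}$.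 Convention: this is $0$ if $k<0$. Cyclic sieving phenomenon: for a finite set $X$ with an action of a cyclic group $\langle g\rangle$ of order $r$ and $f(q)\in\mathbb{N}[q]$, the triple $(X,\langle g\rangle,f(q))$ exhibits the cyclic sieving phenomenon if $|\{x\in X: g^d x=x\}|=f(\omega^d)$ for all $d\ge 0$, where $\omega$ is a primitive $r$-th root of unity. *)

theory Defs
  imports
    Complex_Main
    "HOL-Library.While_Combinator"
    "HOL-Computational_Algebra.Polynomial"
    "HOL-Algebra.Elementary_Groups"
    "HOL-Algebra.Group_Action"
begin

section \<open>Semistandard Young tableaux\<close>

text \<open>
  A cell is a pair (row, column), both counted from 0, in English notation: row 0 is the
  northernmost row and column 0 the westernmost column.  A tableau is a function on all cells
  that is 0 off its diagram; its entries on the diagram are positive.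
\<close>

type_synonym cell = "nat \<times> nat"
type_synonym tableau = "cell \<Rightarrow> nat"

definition diagram :: "nat list \<Rightarrow> cell set" where
  "diagram lam = {(i, j). i < length lam \<and> j < lam ! i}"

definition SSYT :: "nat list \<Rightarrow> nat list \<Rightarrow> tableau set" where
  "SSYT lam mu = {T.
     (\<forall>c. c \<notin> diagram lam \<longrightarrow> T c = 0) \<and>
     (\<forall>c\<in>diagram lam. 1 \<le> T c \<and> T c \<le> length mu) \<and>
     (\<forall>i j j'. j < j' \<and> (i, j') \<in> diagram lam \<longrightarrow> T (i, j) \<le> T (i, j')) \<and>
     (\<forall>i i' j. i < i' \<and> (i', j) \<in> diagram lam \<longrightarrow> T (i, j) < T (i', j)) \<and>
     (\<forall>k<length mu. card {c \<in> diagram lam. T c = Suc k} = mu ! k)}"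


section \<open>Jeu-de-taquin promotion\<close>

datatype box = Outside | Dot | Entry nat

type_synonym filling = "cell \<Rightarrow> box"

definition mark_dots :: "nat \<Rightarrow> tableau \<Rightarrow> filling" where
  "mark_dots k T = (\<lambda>c. if T c = 0 then Outside else if T c = k then Dot else Entry (T c))"

definition unmark_dots :: "filling \<Rightarrow> tableau" where
  "unmark_dots F = (\<lambda>c. case F c of Outside \<Rightarrow> 0 | Dot \<Rightarrow> 1 | Entry x \<Rightarrow> x + 1)"

definition adjacent :: "cell \<Rightarrow> cell \<Rightarrow> bool" where
  "adjacent p q \<longleftrightarrow>
     (fst p = fst q \<and> (snd p = Suc (snd q) \<or> snd q = Suc (snd p))) \<or>
     (snd p = snd q \<and> (fst p = Suc (fst q) \<or> fst q = Suc (fst p)))"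

text \<open>The connected component of dots that contains the northwest corner; it is empty if the
  corner is not a dot.\<close>

definition nw_component :: "filling \<Rightarrow> cell set" where
  "nw_component F =
     {p. F (0, 0) = Dot \<and> (\<lambda>p q. adjacent p q \<and> F q = Dot)\<^sup>*\<^sup>* (0, 0) p}"

definition stray_dots :: "filling \<Rightarrow> cell set" where
  "stray_dots F = {p. F p = Dot} - nw_component F"

fun north :: "filling \<Rightarrow> cell \<Rightarrow> box" where
  "north F (0, j) = Outside"
| "north F (Suc i, j) = F (i, j)"

fun west :: "filling \<Rightarrow> cell \<Rightarrow> box" where
  "west F (i, 0) = Outside"
| "west F (i, Suc j) = F (i, j)"

text \<open>
  The cell with which the dot at the given cell is exchanged.  Only neighbours carrying an entry
  count as present.  The sliding dot is the westernmost one outside the northwest component, and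
  no two dots outside that component share a column, so a dot met to its north or west always
  belongs to the northwest component.  The last case, in which no neighbour carries an entry,
  does not arise for a dot of a semistandard tableau that has yet to join the northwest component.
\<close>

definition slide_target :: "filling \<Rightarrow> cell \<Rightarrow> cell" where
  "slide_target F p =
     (let above = (fst p - 1, snd p); left = (fst p, snd p - 1) in
      case (north F p, west F p) of
        (Entry x, Entry c) \<Rightarrow> if c \<le> x then above else left
      | (Entry x, _) \<Rightarrow> above
      | (_, Entry c) \<Rightarrow> left
      | _ \<Rightarrow> p)"

definition slide_step :: "filling \<times> cell \<Rightarrow> filling \<times> cell" where
  "slide_step = (\<lambda>(F, p). let q = slide_target F p in (F(p := F q, q := F p), q))"

definition slide :: "filling \<Rightarrow> cell \<Rightarrow> filling" where
  "slide F p = fst (while (\<lambda>(F, p). p \<notin> nw_component F) slide_step (F, p))"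

definition westernmost_stray :: "filling \<Rightarrow> cell" where
  "westernmost_stray F = arg_min snd (\<lambda>p. p \<in> stray_dots F)"

definition promotion :: "nat \<Rightarrow> tableau \<Rightarrow> tableau" where
  "promotion k T =
     unmark_dots
       (while (\<lambda>F. stray_dots F \<noteq> {}) (\<lambda>F. slide F (westernmost_stray F)) (mark_dots k T))"

text \<open>The residue class of \<open>z\<close> acts on \<open>X\<close> as the \<open>z\<close>-th power of the \<open>k\<close>-th iterate of
  promotion; the restriction to \<open>X\<close> is the library's convention for elements of
  \<open>BijGroup X\<close>.\<close>

definition promotion_action :: "nat \<Rightarrow> tableau set \<Rightarrow> int \<Rightarrow> tableau \<Rightarrow> tableau" where
  "promotion_action k X z = (\<lambda>T\<in>X. ((promotion k ^^ k) ^^ nat z) T)"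


section \<open>q-binomial coefficients\<close>

definition q_int :: "nat \<Rightarrow> int poly" where
  "q_int N = (monom 1 N - 1) div (monom 1 1 - 1)"

definition q_fact :: "nat \<Rightarrow> int poly" where
  "q_fact N = (\<Prod>i=1..N. q_int i)"

text \<open>The divisions here and above are exact, so they agree with division in the field of
  rational functions.\<close>

definition q_binomial :: "int \<Rightarrow> int \<Rightarrow> int poly" where
  "q_binomial N k =
     (if 0 \<le> k \<and> k \<le> N then q_fact (nat N) div (q_fact (nat k) * q_fact (nat (N - k))) else 0)"

text \<open>The statistic \<open>\<beta>(\<lambda>, \<mu>)\<close> for \<open>\<lambda> = (m, n, \<dots>, n)\<close>; it can be negative.\<close>

definition beta :: "nat \<Rightarrow> nat \<Rightarrow> nat list \<Rightarrow> int" where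
  "beta m n mu =
     int m - int n -
     (\<Sum>i<length mu. if mu ! i > n then int (mu ! i) - int n else 0)"


section \<open>Cyclic sieving\<close>

definition primitive_root_of_unity :: "nat \<Rightarrow> complex \<Rightarrow> bool" where
  "primitive_root_of_unity r w \<longleftrightarrow> w ^ r = 1 \<and> (\<forall>k. 0 < k \<and> k < r \<longrightarrow> w ^ k \<noteq> 1)"

definition eval_at :: "int poly \<Rightarrow> complex \<Rightarrow> complex" where
  "eval_at f z = poly (map_poly of_int f) z"

text \<open>The group \<open>G\<close>, generated by \<open>g\<close>, acts on the finite set \<open>X\<close> through \<open>\<phi>\<close>.  The condition on
  the coefficients says that \<open>f\<close> lies in \<open>\<nat>[q]\<close>.\<close>

definition cyclic_sieving ::
  "('g, 'r) monoid_scheme \<Rightarrow> 'x set \<Rightarrow> ('g \<Rightarrow> 'x \<Rightarrow> 'x) \<Rightarrow> 'g \<Rightarrow> int poly \<Rightarrow> bool" where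
  "cyclic_sieving G X \<phi> g f \<longleftrightarrow>
     finite X \<and> group_action G X \<phi> \<and>
     finite (carrier G) \<and> g \<in> carrier G \<and> subgroup_generated G {g} = G \<and>
     (\<forall>i. 0 \<le> coeff f i) \<and>
     (\<forall>(d::nat) w. primitive_root_of_unity (card (carrier G)) w \<longrightarrow>
        of_nat (card {x \<in> X. \<phi> (g [^]\<^bsub>G\<^esub> d) x = x}) = eval_at f (w ^ d))"

end

theory Submission
  imports Defs "HOL-Computational_Algebra.Polynomial_FPS"
begin

text \<open>
  Each of the first \<open>n\<close> columns of a tableau of shape \<open>(m, n, \<dots>, n)\<close> has \<open>b + 1\<close> strictly
  increasing entries taken from \<open>b + 2\<close> values, so it is known from the one value that it omits.  The
  remaining \<open>m - n\<close> cells lie in the top row.  Hence a tableau is a weakly decreasing word of omitted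
  values together with a weakly increasing word of extra entries, and the only further condition is
  that the least value is not both omitted and extra.  Prescribing the content \<open>\<mu>\<close> fixes, for every
  value \<open>v\<close>, the difference between its multiplicities in the two words.  What remains free is the smaller
  one of these multiplicities, \<open>x\<^sub>v\<close>, and it is 0 for the least value.  Counting the extra
  cells shows that the tableaux correspond to the sequences of \<open>b + 1\<close> natural numbers with sum
  \<open>\<beta>(\<lambda>, \<mu>)\<close> (\<open>bij_betw_decode\<close>).

  In these coordinates promotion is a rotation by one step (\<open>promotion_decode\<close>).  To see this one follows
  the dots.  The dot of a long column climbs to the row of the omitted value, crosses the columns
  that omit the largest value, and climbs to the top row; afterwards every omitted value except the
  largest one is increased by one.  The dots of the top row then move left and push entries 1
  out of the columns that omit the largest value; every such column with a dot on top turns one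
  coincidence of the largest value, omitted and extra, into one of the value 2.  So
  \<open>x\<^sub>b\<^sub>+\<^sub>2\<close> becomes the new \<open>x\<^sub>2\<close>, and the other coordinates move up by one
  (\<open>promotion_hook_tableau\<close>).  Since the rotation has order \<open>b + 1\<close>, also \<open>b + 2\<close> promotions rotate by
  one step, and they restore the content.

  It remains to count the sequences of length \<open>b + 1\<close> and sum \<open>N\<close> that are fixed by the \<open>d\<close>-th power
  of the rotation (\<open>gauss_sieving\<close>).  With \<open>g = gcd d (b + 1)\<close> and \<open>b + 1 = g * s\<close> these are the
  \<open>s\<close>-fold repetitions of sequences of length \<open>g\<close>, so their generating series in \<open>N\<close> is the inverse of
  \<open>(1 - X ^ s) ^ g\<close>.  The generating series of the Gaussian binomials is the inverse of the product of the
  \<open>1 - q ^ i * X\<close> for \<open>i \<le> b\<close>.  At a primitive \<open>s\<close>-th root of unity, such as \<open>\<omega> ^ d\<close>, the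
  factors run \<open>g\<close> times through all \<open>s\<close>-th roots of unity, and the two series agree.
\<close>

section \<open>Tableaux with one long row as pairs of words\<close>

text \<open>Entries and omitted values are shifted down by one, so that they range over \<open>0, \<dots>, b + 1\<close>:
  the long column \<open>j\<close> contains every value except \<open>os ! j\<close>, and \<open>rs\<close> lists the cells of
  the top row to the right of the long columns.\<close>

definition hook_tableau :: "nat \<Rightarrow> nat list \<Rightarrow> nat list \<Rightarrow> tableau" where
  "hook_tableau b os rs = (\<lambda>(i, j).
     if j < length os then
       if i \<le> b then if i < os ! j then i + 1 else i + 2 else 0
     else if i = 0 \<and> j < length os + length rs then rs ! (j - length os) + 1 else 0)"

section \<open>Slides and the northwest component\<close>

lemma slide_done: "p \<in> nw_component F \<Longrightarrow> slide F p = F"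
  unfolding slide_def by (subst while_unfold) simp

lemma slide_once:
  assumes "p \<notin> nw_component F" and "slide_target F p = p'" and "F(p := F p', p' := F p) = F'"
  shows "slide F p = slide F' p'"
  unfolding slide_def using assms
  by (subst while_unfold) (simp add: slide_step_def Let_def)

text \<open>If the dots of the top row begin with a segment that is closed off on the right and below, a path
  of dots from the corner cannot leave it.  All fillings that arise while a dot is on its way have
  this form, hence a moving dot is recognised as stray until it touches the segment.\<close>

lemma nw_component_row:
  assumes dots: "\<And>j. j < t \<Longrightarrow> F (0, j) = Dot"
    and stop: "F (0, t) \<noteq> Dot"
    and below: "\<And>j. j < t \<Longrightarrow> F (1, j) \<noteq> Dot"
  shows "nw_component F = {(0, j) | j. j < t}"
proof (cases "t = 0")
  case True
  then show ?thesis using stop by (simp add: nw_component_def)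
next
  case False
  let ?R = "\<lambda>p q. adjacent p q \<and> F q = Dot"
  have fwd: "\<exists>j<t. p = (0, j)" if "?R\<^sup>*\<^sup>* (0, 0) p" for p
    using that
  proof (induction rule: rtranclp_induct)
    case base
    then show ?case using False by auto
  next
    case (step y z)
    then obtain j where j: "j < t" "y = (0, j)" by auto
    obtain a c where z: "z = (a, c)" by (cases z)
    have "(a = 0 \<and> (c = Suc j \<or> j = Suc c)) \<or> (a = 1 \<and> c = j)"
      using step j z by (auto simp: adjacent_def)
    moreover have "\<not> (a = 1 \<and> c = j)" using below j step z by auto
    moreover have "\<not> (a = 0 \<and> c = t)" using stop j step z by auto
    ultimately show ?case using j z by (metis Suc_lessI Suc_lessD)
  qed
  have bwd: "?R\<^sup>*\<^sup>* (0, 0) (0, j)" if "j < t" for j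
    using that
  proof (induction j)
    case (Suc j)
    then have "?R\<^sup>*\<^sup>* (0, 0) (0, j)" by simp
    moreover have "?R (0, j) (0, Suc j)" using dots Suc.prems by (auto simp: adjacent_def)
    ultimately show ?case by (rule rtranclp.rtrancl_into_rtrancl)
  qed simp
  show ?thesis
    unfolding nw_component_def using fwd bwd dots[of 0] False by auto
qed

text \<open>When a dot reaches the end of the initial segment it may at once connect further dots to the
  corner; the stopping criterion needs only this inclusion.\<close>

lemma nw_component_full_row:
  assumes "\<And>j. j < t \<Longrightarrow> F (0, j) = Dot" and "j < t"
  shows "(0, j) \<in> nw_component F"
proof -
  let ?R = "\<lambda>p q. adjacent p q \<and> F q = Dot"
  have "?R\<^sup>*\<^sup>* (0, 0) (0, j)" using assms(2)
  proof (induction j)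
    case (Suc j)
    then have "?R\<^sup>*\<^sup>* (0, 0) (0, j)" by simp
    moreover have "?R (0, j) (0, Suc j)" using assms(1) Suc.prems by (auto simp: adjacent_def)
    ultimately show ?case by (rule rtranclp.rtrancl_into_rtrancl)
  qed simp
  then show ?thesis using assms by (simp add: nw_component_def)
qed

lemma north_eq: "north F (i, j) = (if i = 0 then Outside else F (i - 1, j))"
  by (cases i) auto

lemma west_eq: "west F (i, j) = (if j = 0 then Outside else F (i, j - 1))"
  by (cases j) auto

text \<open>The form in which single slide steps are chained along a straight part of the path of a dot.\<close>

lemma constant_down:
  fixes l u :: nat
  assumes "l \<le> u" and "\<And>i. l < i \<Longrightarrow> i \<le> u \<Longrightarrow> f i = f (i - 1)"
  shows "f u = f l"
  using assms by (induction rule: dec_induct) auto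

definition settle :: "filling \<Rightarrow> filling" where
  "settle F = while (\<lambda>F. stray_dots F \<noteq> {}) (\<lambda>F. slide F (westernmost_stray F)) F"

lemma settle_done: "stray_dots F = {} \<Longrightarrow> settle F = F"
  unfolding settle_def by (subst while_unfold) simp

text \<open>Stray dots always lie in different columns, so the westernmost one is determined by comparing
  column numbers strictly, in spite of the choice operator in \<open>westernmost_stray\<close>.\<close>

lemma settle_once:
  assumes "p \<in> stray_dots F" and "\<And>q. q \<in> stray_dots F \<Longrightarrow> q \<noteq> p \<Longrightarrow> snd p < snd q"
    and "slide F p = F'"
  shows "settle F = settle F'"
proof -
  have "westernmost_stray F = p"
    unfolding westernmost_stray_def
    using assms(1,2) arg_min_natI[of "\<lambda>p. p \<in> stray_dots F" p snd]
      arg_min_nat_le[of "\<lambda>p. p \<in> stray_dots F" p snd] by (meson leD)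
  then show ?thesis
    unfolding settle_def using assms by (subst while_unfold) auto
qed

section \<open>The path of the dots\<close>

text \<open>The tableau to be promoted has \<open>p\<close> long columns that omit the largest value \<open>b + 1\<close>
  (they are the leftmost ones), long columns omitting the values \<open>os\<close>, and a top row that ends in
  \<open>rs\<close> followed by \<open>q\<close> copies of the largest entry.\<close>

locale hook_promotion =
  fixes b p q :: nat and os rs :: "nat list"
  assumes b_pos: "0 < b"
    and os_le: "\<And>j. j < length os \<Longrightarrow> os ! j \<le> b"
    and os_mono: "\<And>j j'. j \<le> j' \<Longrightarrow> j' < length os \<Longrightarrow> os ! j' \<le> os ! j"
    and rs_le: "\<And>j. j < length rs \<Longrightarrow> rs ! j \<le> b"
begin

text \<open>The filling after the dots of \<open>t\<close> long columns have been moved.  The column that omits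
  \<open>os ! j\<close> has taken the place \<open>j\<close>: it starts with a dot and lacks both \<open>os ! j\<close> and the
  largest value.  The \<open>p\<close> columns that omit the largest value have been pushed to the right of
  these \<open>t\<close> columns.\<close>

definition after_columns :: "nat \<Rightarrow> filling" where
  "after_columns t = (\<lambda>(i, j).
     if j < p + length os then
       if b < i then Outside
       else if j < t then
         if i = 0 then Dot else Entry (if i \<le> os ! j then i else i + 1)
       else if j < t + p then Entry (i + 1)
       else if i = b then Dot else Entry (if i < os ! (j - p) then i + 1 else i + 2)
     else if 0 < i then Outside
     else if j < p + length os + length rs then Entry (rs ! (j - (p + length os)) + 1)
     else if j < p + length os + length rs + q then Dot else Outside)"

text \<open>The path of the next dot, which starts at the bottom of the column \<open>t + p\<close>, has three parts.
  As long as the entry above exceeds the row number by one it is at least as large as the entry to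
  the left, and the dot climbs; this ends in the row of the omitted value \<open>os ! t\<close>.  There the
  entry above is smaller than the one to the left, and the dot crosses the \<open>p\<close> columns that omit
  the largest value.  In column \<open>t\<close> the entries to the left belong to columns that omit a value
  at least as large, so that the tie rule sends the dot up to the surface.  The following three
  fillings have the dot in one cell of each part.\<close>

definition climbing :: "nat \<Rightarrow> nat \<Rightarrow> filling" where
  "climbing t i0 = (\<lambda>(i, j).
     if j = t + p then
       if b < i then Outside
       else if i = i0 then Dot
       else Entry (if i0 < i \<or> i < os ! t then i + 1 else i + 2)
     else after_columns t (i, j))"

definition crossing :: "nat \<Rightarrow> nat \<Rightarrow> filling" where
  "crossing t j0 = (\<lambda>(i, j).
     if t \<le> j \<and> j \<le> t + p then
       if b < i then Outside else if i = os ! t \<and> j = j0 then Dot else Entry (i + 1)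
     else after_columns t (i, j))"

definition surfacing :: "nat \<Rightarrow> nat \<Rightarrow> filling" where
  "surfacing t i0 = (\<lambda>(i, j).
     if t \<le> j \<and> j \<le> t + p then
       if b < i then Outside
       else if j = t \<and> i = i0 then Dot
       else if j = t \<and> i0 < i \<and> i \<le> os ! t then Entry i else Entry (i + 1)
     else after_columns t (i, j))"

lemma nw_columns:
  assumes "t < length os"
  shows "nw_component (after_columns t) = {(0, j) | j. j < t}"
    and "os ! t < i \<Longrightarrow> i \<le> b \<Longrightarrow> nw_component (climbing t i) = {(0, j) | j. j < t}"
    and "t < j \<Longrightarrow> j \<le> t + p \<Longrightarrow> nw_component (crossing t j) = {(0, j) | j. j < t}"
    and "0 < i \<Longrightarrow> i \<le> os ! t \<Longrightarrow> nw_component (surfacing t i) = {(0, j) | j. j < t}"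
  using assms b_pos os_le[of t]
  by (intro nw_component_row;
      auto simp: after_columns_def climbing_def crossing_def surfacing_def)+

text \<open>The entry above is \<open>i + 1\<close>, because the rows between the omitted value and \<open>i\<close> are shifted;
  the entry to the left is at most \<open>i + 1\<close>.\<close>

lemma climb:
  assumes "t < length os" and "os ! t < i" and "i \<le> b"
  shows "slide (climbing t i) (i, t + p) = slide (climbing t (i - 1)) (i - 1, t + p)"
proof (rule slide_once)
  show "(i, t + p) \<notin> nw_component (climbing t i)"
    using assms nw_columns by auto
  have left: "west (climbing t i) (i, t + p) = Entry c \<Longrightarrow> c \<le> i + 1" for c
    using assms os_mono[of "t - 1" t] os_le[of t]
    by (auto simp: west_eq climbing_def after_columns_def split: if_splits)
  have up: "north (climbing t i) (i, t + p) = Entry (i + 1)"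
    using assms by (auto simp: north_eq climbing_def)
  show "slide_target (climbing t i) (i, t + p) = (i - 1, t + p)"
    using left up by (auto simp: slide_target_def Let_def split: box.splits)
  show "(climbing t i)((i, t + p) := climbing t i (i - 1, t + p),
      (i - 1, t + p) := climbing t i (i, t + p)) = climbing t (i - 1)"
    using assms by (auto simp: fun_eq_iff climbing_def)
qed

text \<open>The entry to the left is \<open>os ! t + 1\<close> and the one above, if there is one, is \<open>os ! t\<close>.\<close>

lemma cross:
  assumes "t < length os" and "t < j" and "j \<le> t + p"
  shows "slide (crossing t j) (os ! t, j) = slide (crossing t (j - 1)) (os ! t, j - 1)"
proof (rule slide_once)
  have o: "os ! t \<le> b" using os_le assms by simp
  show "(os ! t, j) \<notin> nw_component (crossing t j)"
    using assms nw_columns by auto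
  have left: "west (crossing t j) (os ! t, j) = Entry (os ! t + 1)"
    using assms o by (auto simp: west_eq crossing_def)
  have up: "north (crossing t j) (os ! t, j) = (if os ! t = 0 then Outside else Entry (os ! t))"
    using assms o by (auto simp: north_eq crossing_def)
  show "slide_target (crossing t j) (os ! t, j) = (os ! t, j - 1)"
    using left up by (auto simp: slide_target_def Let_def split: box.splits if_splits)
  show "(crossing t j)((os ! t, j) := crossing t j (os ! t, j - 1),
      (os ! t, j - 1) := crossing t j (os ! t, j)) = crossing t (j - 1)"
    using assms o by (auto simp: fun_eq_iff crossing_def)
qed

text \<open>The entry above is \<open>i\<close>.  The column to the left, if there is one, is already settled and omits a
  value that is at least \<open>os ! t\<close>, hence at least \<open>i\<close>; so its entry in row \<open>i\<close> is \<open>i\<close>, too.\<close>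

lemma surface:
  assumes "t < length os" and "0 < i" and "i \<le> os ! t"
  shows "slide (surfacing t i) (i, t) = slide (surfacing t (i - 1)) (i - 1, t)"
proof (rule slide_once)
  have o: "os ! t \<le> b" using os_le assms by simp
  show "(i, t) \<notin> nw_component (surfacing t i)"
    using assms nw_columns by auto
  have left: "west (surfacing t i) (i, t) = Entry c \<Longrightarrow> c \<le> i" for c
  proof (cases t)
    case (Suc t')
    then have "i \<le> os ! t'" using assms os_mono[of t' t] by linarith
    then have "surfacing t i (i, t') = Entry i"
      using Suc assms o by (auto simp: surfacing_def after_columns_def)
    then show "west (surfacing t i) (i, t) = Entry c \<Longrightarrow> c \<le> i" using Suc by simp
  qed simp
  have up: "north (surfacing t i) (i, t) = Entry i"
    using assms o by (auto simp: north_eq surfacing_def)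
  show "slide_target (surfacing t i) (i, t) = (i - 1, t)"
    using left up by (auto simp: slide_target_def Let_def split: box.splits)
  show "(surfacing t i)((i, t) := surfacing t i (i - 1, t),
      (i - 1, t) := surfacing t i (i, t)) = surfacing t (i - 1)"
  proof (intro ext, clarify)
    fix i' j'
    consider "j' \<noteq> t" | "j' = t" "i' < i - 1" | "j' = t" "i' = i - 1" | "j' = t" "i' = i"
      | "j' = t" "i < i'" by linarith
    then show "((surfacing t i)((i, t) := surfacing t i (i - 1, t),
      (i - 1, t) := surfacing t i (i, t))) (i', j') = surfacing t (i - 1) (i', j')"
      using assms o by cases (auto simp: surfacing_def)
  qed
qed

lemma slide_column:
  assumes t: "t < length os"
  shows "slide (after_columns t) (b, t + p) = after_columns (Suc t)"
proof -
  have o: "os ! t \<le> b" using os_le t by simp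
  have "after_columns t = climbing t b"
    using t by (auto simp: fun_eq_iff after_columns_def climbing_def)
  moreover have "slide (climbing t b) (b, t + p) = slide (climbing t (os ! t)) (os ! t, t + p)"
    using climb[OF t] o by (intro constant_down[of "os ! t" b "\<lambda>i. slide (climbing t i) (i, t + p)"])
  moreover have "climbing t (os ! t) = crossing t (t + p)"
    using o t by (auto simp: fun_eq_iff climbing_def crossing_def after_columns_def)
  moreover have "slide (crossing t (t + p)) (os ! t, t + p) = slide (crossing t t) (os ! t, t)"
    using cross[OF t] by (intro constant_down[of t "t + p" "\<lambda>j. slide (crossing t j) (os ! t, j)"]) auto
  moreover have "crossing t t = surfacing t (os ! t)"
    by (auto simp: fun_eq_iff crossing_def surfacing_def)
  moreover have "slide (surfacing t (os ! t)) (os ! t, t) = slide (surfacing t 0) (0, t)"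
    using surface[OF t] by (intro constant_down[of 0 "os ! t" "\<lambda>i. slide (surfacing t i) (i, t)"]) auto
  moreover have "surfacing t 0 = after_columns (Suc t)"
  proof (intro ext, clarify)
    fix i j
    consider "j < t" | "j = t" | "t < j" "j \<le> t + p" | "t + p < j" by linarith
    then show "surfacing t 0 (i, j) = after_columns (Suc t) (i, j)"
      using t o by cases (auto simp: surfacing_def after_columns_def)
  qed
  moreover have "slide (after_columns (Suc t)) (0, t) = after_columns (Suc t)"
    using t by (intro slide_done nw_component_full_row[of "Suc t"]) (auto simp: after_columns_def)
  ultimately show ?thesis by simp
qed

lemma settle_columns:
  assumes "t \<le> length os"
  shows "settle (after_columns t) = settle (after_columns (length os))"
  using assms
proof (induction rule: inc_induct)
  case (step t)
  have nw: "nw_component (after_columns t) = {(0, j) | j. j < t}"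
    using nw_columns step by simp
  have dots: "after_columns t (i, j) = Dot \<longleftrightarrow>
      i = 0 \<and> j < t \<or> i = b \<and> t + p \<le> j \<and> j < p + length os
      \<or> i = 0 \<and> p + length os + length rs \<le> j \<and> j < p + length os + length rs + q" for i j
    using step b_pos by (auto simp: after_columns_def)
  have "settle (after_columns t) = settle (after_columns (Suc t))"
    using step by (intro settle_once[OF _ _ slide_column]) (auto simp: stray_dots_def nw dots)
  then show ?case using step.IH by simp
qed simp

text \<open>The filling after all long columns and \<open>s\<close> dots of the top row have been moved.  The entries of
  the top row that are not dots are the \<open>p\<close> ones at the top of the columns omitting the largest value,
  followed by the shifted \<open>rs\<close>; each of the \<open>s\<close> dots has moved all of them one cell to the right.\<close>

definition after_row :: "nat \<Rightarrow> filling" where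
  "after_row s = (\<lambda>(i, j).
     if 0 < i then
       if j < p + length os \<and> i \<le> b then
         Entry (if j < length os \<and> i \<le> os ! j then i else i + 1)
       else Outside
     else if j < length os + s then Dot
     else if j < length os + s + p + length rs then
       Entry ((replicate p 1 @ map Suc rs) ! (j - (length os + s)))
     else if j < length os + length rs + p + q then Dot else Outside)"

definition crossing_row :: "nat \<Rightarrow> nat \<Rightarrow> filling" where
  "crossing_row s j0 = (\<lambda>(i, j).
     if i = 0 \<and> length os + s \<le> j \<and> j \<le> length os + s + p + length rs then
       if j = j0 then Dot
       else Entry ((replicate p 1 @ map Suc rs) ! (if j < j0 then j - (length os + s) else j - Suc (length os + s)))
     else after_row s (i, j))"

lemma nw_row:
  assumes "s < q" and "0 < p + length rs"
  shows "nw_component (after_row s) = {(0, j) | j. j < length os + s}"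
    and "length os + s < j \<Longrightarrow> nw_component (crossing_row s j) = {(0, j) | j. j < length os + s}"
  using assms
  by (intro nw_component_row; auto simp: after_row_def crossing_row_def)+

lemma cross_row:
  assumes "s < q" and "length os + s < j" and "j \<le> length os + s + p + length rs"
  shows "slide (crossing_row s j) (0, j) = slide (crossing_row s (j - 1)) (0, j - 1)"
proof (rule slide_once)
  have "0 < p + length rs" using assms by linarith
  then show "(0, j) \<notin> nw_component (crossing_row s j)"
    using assms nw_row(2)[of s j] by auto
  show "slide_target (crossing_row s j) (0, j) = (0, j - 1)"
    using assms by (auto simp: slide_target_def Let_def west_eq north_eq crossing_row_def)
  show "(crossing_row s j)((0, j) := crossing_row s j (0, j - 1),
      (0, j - 1) := crossing_row s j (0, j)) = crossing_row s (j - 1)"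
  proof (intro ext, clarify)
    fix i j'
    consider "j' < j - 1" | "j' = j - 1" | "j' = j" | "j < j'" by linarith
    then show "((crossing_row s j)((0, j) := crossing_row s j (0, j - 1),
      (0, j - 1) := crossing_row s j (0, j))) (i, j') = crossing_row s (j - 1) (i, j')"
      using assms by cases (auto simp: crossing_row_def)
  qed
qed

lemma slide_row:
  assumes s: "s < q"
  shows "slide (after_row s) (0, length os + s + p + length rs) = after_row (Suc s)"
proof -
  let ?w = "length os + s"
  have "after_row s = crossing_row s (?w + p + length rs)"
    using s by (auto simp: fun_eq_iff after_row_def crossing_row_def)
  moreover have "slide (crossing_row s (?w + p + length rs)) (0, ?w + p + length rs) =
      slide (crossing_row s ?w) (0, ?w)"
    using cross_row[OF s]
    by (intro constant_down[of ?w "?w + p + length rs" "\<lambda>j. slide (crossing_row s j) (0, j)"]) auto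
  moreover have "crossing_row s ?w = after_row (Suc s)"
    using s by (auto simp: fun_eq_iff after_row_def crossing_row_def)
  moreover have "slide (after_row (Suc s)) (0, ?w) = after_row (Suc s)"
    by (intro slide_done nw_component_full_row[of "Suc ?w"]) (auto simp: after_row_def)
  ultimately show ?thesis by simp
qed

lemma stray_after_rows: "stray_dots (after_row q) = {}"
proof -
  have dots: "after_row q (i, j) = Dot \<longleftrightarrow> i = 0 \<and> j < length os + q" for i j
    by (auto simp: after_row_def)
  have "(0, j) \<in> nw_component (after_row q)" if "j < length os + q" for j
    using that by (intro nw_component_full_row[of "length os + q"]) (auto simp: dots)
  then show ?thesis by (auto simp: stray_dots_def dots)
qed

lemma settle_row:
  assumes "s \<le> q"
  shows "settle (after_row s) = after_row q"
  using assms
proof (induction rule: inc_induct)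
  case base
  show ?case using stray_after_rows by (rule settle_done)
next
  case (step s)
  show ?case
  proof (cases "0 < p + length rs")
    case True
    have nw: "nw_component (after_row s) = {(0, j) | j. j < length os + s}"
      using nw_row True step by simp
    have dots: "after_row s (i, j) = Dot \<longleftrightarrow> i = 0 \<and> (j < length os + s \<or>
        length os + s + p + length rs \<le> j \<and> j < length os + length rs + p + q)" for i j
      using step by (auto simp: after_row_def)
    have "settle (after_row s) = settle (after_row (Suc s))"
      using step True by (intro settle_once[OF _ _ slide_row]) (auto simp: stray_dots_def nw dots)
    then show ?thesis using step.IH by simp
  next
    case False
    \<comment> \<open>The top row consists of dots only, so they all belong to the northwest component
        and no further slide takes place.\<close>
    then have "after_row s = after_row q"
      using step.hyps unfolding after_row_def by (auto simp: fun_eq_iff)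
    then show ?thesis using stray_after_rows settle_done by simp
  qed
qed

text \<open>In the final filling the \<open>q\<close> dots of the top row occupy the cells that follow the first
  \<open>length os\<close> columns.  They are on top of a column omitting the largest value for
  \<open>min p q\<close> columns; since the dot becomes the least value, such a column now omits the second
  value, and the entry that it lost is found among the extra cells of the row as a second value.
  The surplus of \<open>p\<close> or \<open>q\<close> turns into omissions or extra entries of the least value.\<close>

lemma promotion_hook_tableau:
  "promotion (b + 2) (hook_tableau b (replicate p (b + 1) @ os) (rs @ replicate q (b + 1))) =
   hook_tableau b (map Suc os @ replicate (min p q) 1 @ replicate (p - q) 0)
     (replicate (q - p) 0 @ replicate (min p q) 1 @ map Suc rs)"
  (is "promotion _ ?T = ?T'")
proof -
  have start: "mark_dots (b + 2) ?T = after_columns 0"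
  proof (intro ext, clarify)
    fix i j
    consider "j < p" | "p \<le> j" "j < p + length os"
      | "p + length os \<le> j" "j < p + length os + length rs" | "p + length os + length rs \<le> j"
      by linarith
    then show "mark_dots (b + 2) ?T (i, j) = after_columns 0 (i, j)"
    proof cases
      case 2
      then have "os ! (j - p) \<le> b" by (intro os_le) auto
      then show ?thesis
        using 2 by (auto simp: mark_dots_def hook_tableau_def after_columns_def nth_append)
    next
      case 3
      then have "rs ! (j - (p + length os)) \<le> b" by (intro rs_le) auto
      then show ?thesis
        using 3 by (auto simp: mark_dots_def hook_tableau_def after_columns_def nth_append)
    qed (auto simp: mark_dots_def hook_tableau_def after_columns_def nth_append)
  qed
  have middle: "after_columns (length os) = after_row 0"
    by (auto simp: fun_eq_iff after_columns_def after_row_def nth_append add.commute[of p])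
  define os' where "os' = map Suc os @ replicate (min p q) 1 @ replicate (p - q) 0"
  define rs' where "rs' = replicate (q - p) 0 @ replicate (min p q) 1 @ map Suc rs"
  define n where "n = length os + p"
  have len: "length os' = n" "length rs' = length rs + q" by (auto simp: os'_def rs'_def n_def)
  have finish: "unmark_dots (after_row q) = hook_tableau b os' rs'"
  proof (intro ext, clarify)
    fix i j
    let ?row = "(replicate p 1 @ map Suc rs) ! (j - (length os + q))"
    have rows: "unmark_dots (after_row q) (i, j) = (
      if 0 < i then if j < n \<and> i \<le> b then (if j < length os \<and> i \<le> os ! j then i + 1 else i + 2) else 0
      else if j < length os + q then 1
      else if j < n + q + length rs then ?row + 1 else 0)"
      by (auto simp: unmark_dots_def after_row_def n_def)
    consider "j < length os" | "length os \<le> j" "j < length os + q" "j < n"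
      | "length os + q \<le> j" "j < n" | "n \<le> j" "j < length os + q"
      | "n \<le> j" "length os + q \<le> j" "j < n + q"
      | "n + q \<le> j" "j < n + q + length rs" | "n + q + length rs \<le> j" by linarith
    then show "unmark_dots (after_row q) (i, j) = hook_tableau b os' rs' (i, j)"
    proof cases
      case 1
      then have "os' ! j = Suc (os ! j)" by (auto simp: os'_def nth_append)
      then show ?thesis using 1 by (auto simp: rows hook_tableau_def len n_def)
    next
      case 2
      then have "os' ! j = 1" by (auto simp: os'_def nth_append n_def)
      then show ?thesis using 2 by (auto simp: rows hook_tableau_def len n_def)
    next
      case 3
      then have "os' ! j = 0" "?row = 1" by (auto simp: os'_def nth_append n_def)
      then show ?thesis using 3 by (auto simp: rows hook_tableau_def len n_def)
    next
      case 4
      then have "rs' ! (j - n) = 0" by (auto simp: rs'_def nth_append n_def)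
      then show ?thesis using 4 by (auto simp: rows hook_tableau_def len n_def)
    next
      case 5
      then have "rs' ! (j - n) = 1" "?row = 1" by (auto simp: rs'_def nth_append n_def)
      then show ?thesis using 5 by (auto simp: rows hook_tableau_def len n_def)
    next
      case 6
      then have "j - n = length (replicate (q - p) 0 @ replicate (min p q) (1::nat)) + (j - (n + q))"
        by (auto simp: n_def)
      then have "rs' ! (j - n) = map Suc rs ! (j - (n + q))"
        unfolding rs'_def by (metis append_assoc nth_append_length_plus)
      moreover have "?row = map Suc rs ! (j - (n + q))"
        using 6 by (auto simp: nth_append n_def add.commute add.left_commute)
      ultimately show ?thesis using 6 by (auto simp: rows hook_tableau_def len n_def)
    next
      case 7
      then show ?thesis by (auto simp: rows hook_tableau_def len n_def)
    qed
  qed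
  have "promotion (b + 2) ?T = unmark_dots (settle (after_columns 0))"
    unfolding promotion_def settle_def start ..
  also have "settle (after_columns 0) = after_row q"
    using settle_columns[of 0] settle_row[of 0] middle by simp
  finally show ?thesis using finish unfolding os'_def rs'_def by simp
qed

end

section \<open>Coordinates on the tableaux of given content\<close>

text \<open>The sorted word in which \<open>v < k\<close> occurs \<open>c v\<close> times.\<close>

definition blocks :: "(nat \<Rightarrow> nat) \<Rightarrow> nat \<Rightarrow> nat list" where
  "blocks c k = concat (map (\<lambda>v. replicate (c v) v) [0..<k])"

lemma blocks_0 [simp]: "blocks c 0 = []"
  by (simp add: blocks_def)

lemma blocks_snoc: "blocks c (Suc k) = blocks c k @ replicate (c k) k"
  by (simp add: blocks_def)

lemma blocks_cons: "blocks c (Suc k) = replicate (c 0) 0 @ map Suc (blocks (\<lambda>v. c (Suc v)) k)"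
proof (induction k)
  case (Suc k)
  then show ?case by (subst blocks_snoc) (simp add: blocks_snoc)
qed (simp add: blocks_def)

lemma blocks_cong: "(\<And>v. v < k \<Longrightarrow> c v = c' v) \<Longrightarrow> blocks c k = blocks c' k"
  unfolding blocks_def by (intro arg_cong[of _ _ concat] map_cong) auto

lemma count_list_replicate: "count_list (replicate a x) v = (if v = x then a else 0)"
  by (induction a) auto

lemma count_list_blocks: "count_list (blocks c k) v = (if v < k then c v else 0)"
  by (induction k) (auto simp: blocks_snoc count_list_replicate)

lemma length_blocks: "length (blocks c k) = (\<Sum>v<k. c v)"
  by (induction k) (auto simp: blocks_snoc)

lemma set_blocks: "set (blocks c k) \<subseteq> {..<k}"
  by (auto simp: blocks_def)

lemma sorted_blocks: "sorted (blocks c k)"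
proof (induction k)
  case (Suc k)
  then show ?case using set_blocks[of c k] by (force simp: blocks_snoc sorted_append)
qed simp

lemma sorted_eq_blocks:
  assumes "sorted xs" and "set xs \<subseteq> {..<k}" and "\<And>v. v < k \<Longrightarrow> count_list xs v = c v"
  shows "xs = blocks c k"
proof -
  have "mset xs = mset (blocks c k)"
  proof (rule multiset_eqI)
    fix v
    show "count (mset xs) v = count (mset (blocks c k)) v"
      using assms(2) assms(3)[of v] by (auto simp: count_mset count_list_blocks count_list_0_iff)
  qed
  then show ?thesis using assms(1) sorted_blocks by (metis properties_for_sort)
qed

lemma length_eq_sum_counts:
  fixes xs :: "nat list"
  assumes "sorted xs" and "set xs \<subseteq> {..<k}"
  shows "length xs = (\<Sum>v<k. count_list xs v)"
  using sorted_eq_blocks[of xs k "count_list xs"] assms length_blocks by metis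

text \<open>The words produced by promotion are again sorted, and their multiplicities are shifted by one except
  for the least two values.\<close>

lemma shift_blocks:
  assumes "c' 0 = z" and "c' 1 = w + c 0" and "\<And>v. v < b \<Longrightarrow> c' (Suc (Suc v)) = c (Suc v)"
  shows "replicate z 0 @ replicate w 1 @ map Suc (blocks c (b + 1)) = blocks c' (b + 2)"
proof -
  have "blocks (\<lambda>v. c' (Suc (Suc v))) b = blocks (\<lambda>v. c (Suc v)) b"
    using assms(3) by (rule blocks_cong)
  then show ?thesis
    using assms(1,2) by (simp add: blocks_cons replicate_add)
qed

lemma rotate_last:
  assumes "xs \<noteq> []"
  shows "rotate (length xs - 1) xs = last xs # butlast xs"
  using rotate_append[of "butlast xs" "[last xs]"] assms by simp

text \<open>The multiplicities of a value among the omitted values and among the extra entries, in terms of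
  the smaller one of the two.  Prepending 0 to \<open>xs\<close> expresses that the least value cannot be
  both omitted and extra.\<close>

definition omissions :: "nat \<Rightarrow> nat list \<Rightarrow> nat list \<Rightarrow> nat \<Rightarrow> nat" where
  "omissions n mu xs v = (0 # xs) ! v + (n - mu ! v)"

definition extras :: "nat \<Rightarrow> nat list \<Rightarrow> nat list \<Rightarrow> nat \<Rightarrow> nat" where
  "extras n mu xs v = (0 # xs) ! v + (mu ! v - n)"

definition decode :: "nat \<Rightarrow> nat \<Rightarrow> nat list \<Rightarrow> nat list \<Rightarrow> tableau" where
  "decode b n mu xs =
     hook_tableau b (rev (blocks (omissions n mu xs) (b + 2))) (blocks (extras n mu xs) (b + 2))"

text \<open>Both multiplicities of the largest value contain the common part \<open>xs ! b\<close>, and by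
  \<open>promotion_hook_tableau\<close> exactly this part is transferred to the second value; every other
  value is replaced by its successor.  Rotating a list by its length minus one moves its last
  element to the front.\<close>

lemma promotion_decode:
  assumes b: "0 < b" and mu: "length mu = b + 2" and xs: "length xs = b + 1"
  shows "promotion (b + 2) (decode b n mu xs) =
    decode b n (rotate (b + 1) mu) (rotate b xs)"
proof -
  let ?co = "omissions n mu xs" and ?cr = "extras n mu xs"
  let ?mu = "rotate (b + 1) mu" and ?xs = "rotate b xs"
  let ?p = "?co (b + 1)" and ?q = "?cr (b + 1)"
  interpret hook_promotion b ?p ?q "rev (blocks ?co (b + 1))" "blocks ?cr (b + 1)"
  proof
    show "rev (blocks ?co (b + 1)) ! j \<le> b" if "j < length (rev (blocks ?co (b + 1)))" for j
      using set_blocks[of ?co "b + 1"] nth_mem[OF that] by force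
    show "blocks ?cr (b + 1) ! j \<le> b" if "j < length (blocks ?cr (b + 1))" for j
      using set_blocks[of ?cr "b + 1"] nth_mem[OF that] by force
    show "rev (blocks ?co (b + 1)) ! j' \<le> rev (blocks ?co (b + 1)) ! j"
      if "j \<le> j'" "j' < length (rev (blocks ?co (b + 1)))" for j j'
      using sorted_blocks[of ?co "b + 1"] that by (simp add: sorted_rev_nth_mono)
  qed (rule b)
  have mu0: "?mu ! 0 = mu ! (b + 1)" and muS: "v < b + 1 \<Longrightarrow> ?mu ! Suc v = mu ! v" for v
  proof -
    have "mu \<noteq> []" using mu by auto
    then have "?mu = last mu # butlast mu" using rotate_last[of mu] mu by simp
    then show "?mu ! 0 = mu ! (b + 1)" "v < b + 1 \<Longrightarrow> ?mu ! Suc v = mu ! v" for v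
      using mu \<open>mu \<noteq> []\<close> by (auto simp: nth_butlast last_conv_nth)
  qed
  have xs0: "?xs ! 0 = xs ! b" and xsS: "v < b \<Longrightarrow> ?xs ! Suc v = xs ! v" for v
  proof -
    have "xs \<noteq> []" using xs by auto
    then have "?xs = last xs # butlast xs" using rotate_last[of xs] xs by simp
    then show "?xs ! 0 = xs ! b" "v < b \<Longrightarrow> ?xs ! Suc v = xs ! v" for v
      using xs \<open>xs \<noteq> []\<close> by (auto simp: nth_butlast last_conv_nth)
  qed
  have pq: "?p - ?q = n - mu ! (b + 1)" "?q - ?p = mu ! (b + 1) - n" "min ?p ?q = xs ! b"
    by (auto simp: omissions_def extras_def)
  have rs: "replicate (?q - ?p) 0 @ replicate (min ?p ?q) 1 @ map Suc (blocks ?cr (b + 1)) =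
      blocks (extras n ?mu ?xs) (b + 2)"
    unfolding pq
    by (rule shift_blocks) (use mu0 muS[of 0] muS xs0 xsS in \<open>auto simp: extras_def\<close>)
  have "replicate (?p - ?q) 0 @ replicate (min ?p ?q) 1 @ map Suc (blocks ?co (b + 1)) =
      blocks (omissions n ?mu ?xs) (b + 2)"
    unfolding pq
    by (rule shift_blocks) (use mu0 muS[of 0] muS xs0 xsS in \<open>auto simp: omissions_def\<close>)
  then have "rev (replicate (?p - ?q) 0 @ replicate (min ?p ?q) 1 @ map Suc (blocks ?co (b + 1))) =
      rev (blocks (omissions n ?mu ?xs) (b + 2))"
    by (rule arg_cong)
  then have os: "map Suc (rev (blocks ?co (b + 1))) @ replicate (min ?p ?q) 1 @ replicate (?p - ?q) 0 =
      rev (blocks (omissions n ?mu ?xs) (b + 2))"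
    by (simp add: rev_map)
  have T: "decode b n mu xs =
      hook_tableau b (replicate ?p (b + 1) @ rev (blocks ?co (b + 1)))
        (blocks ?cr (b + 1) @ replicate ?q (b + 1))"
    by (simp add: decode_def blocks_snoc)
  show ?thesis
    unfolding T promotion_hook_tableau os rs by (simp add: decode_def)
qed

lemma promotion_power_decode:
  assumes "0 < b" and "length mu = b + 2" and "length xs = b + 1"
  shows "(promotion (b + 2) ^^ j) (decode b n mu xs) =
    decode b n (rotate (j * (b + 1)) mu) (rotate (j * b) xs)"
proof (induction j)
  case (Suc j)
  then show ?case
    using assms promotion_decode[of b "rotate (j * (b + 1)) mu" "rotate (j * b) xs"]
    by (simp add: rotate_rotate algebra_simps)
qed simp

text \<open>After a multiple of \<open>b + 2\<close> promotions the content is back at its original value.\<close>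

lemma promotion_full_turns:
  assumes "0 < b" and "length mu = b + 2" and "length xs = b + 1"
  shows "(promotion (b + 2) ^^ ((b + 2) * d)) (decode b n mu xs) =
    decode b n mu (rotate ((b + 2) * d * b) xs)"
  using promotion_power_decode[OF assms] assms rotate_id[of "(b + 2) * d * (b + 1)" mu]
  by (metis id_apply mod_mult_self1_is_0 mult.assoc)

lemma diagram_hook:
  "(i, j) \<in> diagram ((n + l) # replicate b n) \<longleftrightarrow> i \<le> b \<and> j < n \<or> i = 0 \<and> n \<le> j \<and> j < n + l"
  by (cases i) (auto simp: diagram_def)

text \<open>A value occurs exactly once in each long column that does not omit it.\<close>

lemma content_hook_tableau:
  assumes "length os = n" and "length rs = l" and "set os \<subseteq> {..b + 1}" and "k \<le> b + 1"
  shows "card {c \<in> diagram ((n + l) # replicate b n). hook_tableau b os rs c = Suc k} + count_list os k =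
    n + count_list rs k"
proof -
  let ?f = "\<lambda>j. (if k < os ! j then k else k - 1, j)" and ?g = "\<lambda>j. (0, n + j)"
  let ?A = "{j. j < n \<and> os ! j \<noteq> k}" and ?B = "{j. j < l \<and> rs ! j = k}"
  have "{c \<in> diagram ((n + l) # replicate b n). hook_tableau b os rs c = Suc k} = ?f ` ?A \<union> ?g ` ?B"
    (is "?L = ?R")
  proof (rule Set.set_eqI, rule iffI)
    fix c assume "c \<in> ?L"
    then obtain i j where c: "c = (i, j)" "(i, j) \<in> diagram ((n + l) # replicate b n)"
      "hook_tableau b os rs (i, j) = Suc k" by (cases c) auto
    show "c \<in> ?R"
    proof (cases "j < n")
      case True
      then have "j \<in> ?A" "c = ?f j"
        using c assms by (auto simp: hook_tableau_def diagram_hook split: if_splits)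
      then show ?thesis by blast
    next
      case False
      then have "j - n \<in> ?B" "c = ?g (j - n)"
        using c assms by (auto simp: hook_tableau_def diagram_hook split: if_splits)
      then show ?thesis by blast
    qed
  next
    fix c assume "c \<in> ?R"
    moreover have "?f j \<in> ?L" if "j \<in> ?A" for j
    proof -
      have "os ! j \<in> set os" using that assms by simp
      then have "os ! j \<le> b + 1" using assms by auto
      then show ?thesis using that assms by (auto simp: hook_tableau_def diagram_hook)
    qed
    moreover have "?g j \<in> ?L" if "j \<in> ?B" for j
      using that assms by (auto simp: hook_tableau_def diagram_hook)
    ultimately show "c \<in> ?L" by blast
  qed
  moreover have "card (?f ` ?A \<union> ?g ` ?B) = card ?A + card ?B"
    by (subst card_Un_disjoint) (auto simp: card_image inj_on_def)
  moreover have "card ?A + count_list os k = n"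
    using assms(1) sum_length_filter_compl[of "(=) k" os]
      length_filter_conv_card[of "\<lambda>x. k \<noteq> x" os]
    by (simp add: count_list_eq_length_filter neq_commute)
  moreover have "card ?B = count_list rs k"
    using assms(2) length_filter_conv_card[of "(=) k" rs]
    by (simp add: count_list_eq_length_filter eq_commute)
  ultimately show ?thesis by simp
qed

lemma hook_tableau_in_SSYT:
  assumes "length os = n" and "length rs = l" and "length mu = b + 2"
    and os: "sorted (rev os)" "set os \<subseteq> {..b + 1}"
    and rs: "sorted rs" "set rs \<subseteq> {..b + 1}"
    and corner: "0 \<notin> set os \<or> 0 \<notin> set rs"
    and content: "\<And>v. v < b + 2 \<Longrightarrow> n + count_list rs v = mu ! v + count_list os v"
  shows "hook_tableau b os rs \<in> SSYT ((n + l) # replicate b n) mu"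
proof -
  let ?D = "diagram ((n + l) # replicate b n)" and ?T = "hook_tableau b os rs"
  have os_le: "os ! j \<le> b + 1" if "j < n" for j
    using that assms(1) os(2) by (meson atMost_iff nth_mem subsetD)
  have rs_le: "rs ! j \<le> b + 1" if "j < l" for j
    using that assms(2) rs(2) by (meson atMost_iff nth_mem subsetD)
  have os_mono: "os ! j' \<le> os ! j" if "j \<le> j'" "j' < n" for j j'
    using that assms sorted_rev_nth_mono by blast
  have rs_mono: "rs ! j \<le> rs ! j'" if "j \<le> j'" "j' < l" for j j'
    using that assms sorted_nth_mono by blast
  have corner': "os ! j \<noteq> 0 \<or> rs ! j' \<noteq> 0" if "j < n" "j' < l" for j j'
    using that assms by (metis nth_mem)
  have "?T c = 0" if "c \<notin> ?D" for c
    using that assms by (cases c) (auto simp: hook_tableau_def diagram_hook)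
  moreover have "1 \<le> ?T c \<and> ?T c \<le> length mu" if c: "c \<in> ?D" for c
  proof (cases c)
    case (Pair i j)
    then consider "j < n" "i \<le> b" | "n \<le> j" "i = 0" "j - n < l"
      using c by (auto simp: diagram_hook less_diff_conv2)
    then show ?thesis
      using assms os_le[of j] rs_le[of "j - n"] Pair by cases (auto simp: hook_tableau_def)
  qed
  moreover have "?T (i, j) \<le> ?T (i, j')" if cells: "j < j'" "(i, j') \<in> ?D" for i j j'
  proof -
    from cells(2) consider "j' < n" "i \<le> b" | "n \<le> j'" "i = 0" "j' - n < l" "j < n"
      | "n \<le> j'" "i = 0" "j' - n < l" "n \<le> j"
      by (auto simp: diagram_hook less_diff_conv2) (metis not_less)
    then show ?thesis
    proof cases
      case 1
      then show ?thesis using cells assms os_mono[of j j'] by (auto simp: hook_tableau_def)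
    next
      case 2
      then show ?thesis using cells assms corner'[of j "j' - n"] by (auto simp: hook_tableau_def)
    next
      case 3
      then show ?thesis using cells assms rs_mono[of "j - n" "j' - n"] by (auto simp: hook_tableau_def)
    qed
  qed
  moreover have "?T (i, j) < ?T (i', j)" if "i < i'" "(i', j) \<in> ?D" for i i' j
    using that assms by (auto simp: hook_tableau_def diagram_hook)
  moreover have "card {c \<in> ?D. ?T c = Suc k} = mu ! k" if "k < length mu" for k
    using content_hook_tableau[of os n rs l b k] content[of k] that assms by auto
  ultimately show ?thesis unfolding SSYT_def by blast
qed

text \<open>The entry in row \<open>i\<close> is bounded below by the \<open>i\<close> entries above it and bounded above by the
  \<open>b - i\<close> entries below it, which leaves only \<open>i + 1\<close> and \<open>i + 2\<close>; after the first
  \<open>i + 2\<close> strictness excludes a return.\<close>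

lemma column_omits_one_value:
  fixes f :: "nat \<Rightarrow> nat"
  assumes mono: "\<And>i i'. i < i' \<Longrightarrow> i' \<le> b \<Longrightarrow> f i < f i'" and pos: "1 \<le> f 0" and top: "f b \<le> b + 2"
  shows "\<exists>u\<le>b + 1. \<forall>i\<le>b. f i = (if i < u then i + 1 else i + 2)"
proof -
  have low: "i + 1 \<le> f i" if "i \<le> b" for i
    using that
  proof (induction i)
    case (Suc i)
    then show ?case using mono[of i "Suc i"] by simp
  qed (use pos in simp)
  have high: "f i \<le> i + 2" if "i \<le> b" for i
    using that
  proof (induction rule: inc_induct)
    case (step i)
    then show ?case using mono[of i "Suc i"] by simp
  qed (use top in simp)
  define u where "u = (LEAST u. u = b + 1 \<or> f u = u + 2)"
  have u: "u = b + 1 \<or> f u = u + 2" unfolding u_def by (rule LeastI) auto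
  have min: "\<not> (i = b + 1 \<or> f i = i + 2)" if "i < u" for i
    using that not_less_Least unfolding u_def by blast
  have "u \<le> b + 1" unfolding u_def by (rule Least_le) auto
  moreover have "f i = i + 1" if "i < u" "i \<le> b" for i
    using low[of i] high[of i] min[of i] that by auto
  moreover have "f i = i + 2" if "u \<le> i" "i \<le> b" for i
    using that
  proof (induction rule: dec_induct)
    case base
    then show ?case using u by auto
  next
    case (step i)
    then show ?case using mono[of i "Suc i"] high[of "Suc i"] by simp
  qed
  ultimately show ?thesis by (metis not_less)
qed

text \<open>Weakly increasing rows mean that the omitted values decrease weakly from left to right.  At the end of
  the long columns the top row imposes one more condition: a column omitting the least value
  has the second value on top and cannot be followed by the least one.\<close>

lemma SSYT_hook_tableauE:
  assumes T: "T \<in> SSYT ((n + l) # replicate b n) mu" and mu: "length mu = b + 2"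
  obtains os rs where "T = hook_tableau b os rs" "length os = n" "length rs = l"
    "sorted (rev os)" "set os \<subseteq> {..b + 1}" "sorted rs" "set rs \<subseteq> {..b + 1}"
    "0 \<notin> set os \<or> 0 \<notin> set rs"
    "\<And>v. v < b + 2 \<Longrightarrow> n + count_list rs v = mu ! v + count_list os v"
proof -
  let ?D = "diagram ((n + l) # replicate b n)"
  have off: "c \<notin> ?D \<Longrightarrow> T c = 0" for c
    using T unfolding SSYT_def by blast
  have bounds: "c \<in> ?D \<Longrightarrow> 1 \<le> T c \<and> T c \<le> b + 2" for c
    using T mu by (auto simp: SSYT_def)
  have row: "j < j' \<Longrightarrow> (i, j') \<in> ?D \<Longrightarrow> T (i, j) \<le> T (i, j')" for i j j'
    using T by (auto simp: SSYT_def)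
  have col: "i < i' \<Longrightarrow> (i', j) \<in> ?D \<Longrightarrow> T (i, j) < T (i', j)" for i i' j
    using T by (auto simp: SSYT_def)
  have card: "k < b + 2 \<Longrightarrow> card {c \<in> ?D. T c = Suc k} = mu ! k" for k
    using T mu by (auto simp: SSYT_def)
  have "\<exists>u. j < n \<longrightarrow> u \<le> b + 1 \<and> (\<forall>i\<le>b. T (i, j) = (if i < u then i + 1 else i + 2))" for j
  proof (cases "j < n")
    case True
    then show ?thesis
      using column_omits_one_value[of b "\<lambda>i. T (i, j)"] col bounds[of "(0, j)"] bounds[of "(b, j)"]
      by (auto simp: diagram_hook)
  qed simp
  then obtain u where u: "\<And>j. j < n \<Longrightarrow> u j \<le> b + 1"
    and Tu: "\<And>i j. j < n \<Longrightarrow> i \<le> b \<Longrightarrow> T (i, j) = (if i < u j then i + 1 else i + 2)"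
    by metis
  define os where "os = map u [0..<n]"
  define rs where "rs = map (\<lambda>j. T (0, n + j) - 1) [0..<l]"
  have eq: "T = hook_tableau b os rs"
  proof (intro ext, clarify)
    fix i j
    show "T (i, j) = hook_tableau b os rs (i, j)"
    proof (cases "(i, j) \<in> ?D")
      case True
      then show ?thesis
        using Tu[of j i] bounds[OF True] by (auto simp: hook_tableau_def os_def rs_def diagram_hook)
    next
      case False
      then show ?thesis
        using off[OF False] by (auto simp: hook_tableau_def os_def rs_def diagram_hook)
    qed
  qed
  have u_mono: "u j' \<le> u j" if "j < j'" "j' < n" for j j'
  proof (rule ccontr)
    assume "\<not> u j' \<le> u j"
    then have "u j < u j'" "u j \<le> b" using u[of j'] that by auto
    then show False using row[of j j' "u j"] Tu[of j "u j"] Tu[of j' "u j"] that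
      by (auto simp: diagram_hook)
  qed
  show thesis
  proof (rule that[OF eq])
    show "length os = n" "length rs = l" by (auto simp: os_def rs_def)
    show os_le: "set os \<subseteq> {..b + 1}" using u by (auto simp: os_def)
    show "sorted (rev os)"
      using u_mono by (auto simp: os_def sorted_rev_iff_nth_mono le_less)
    show "sorted rs"
      unfolding sorted_iff_nth_mono
    proof (intro allI impI)
      fix i j assume "i \<le> j" "j < length rs"
      then show "rs ! i \<le> rs ! j"
        using row[of "n + i" "n + j" 0] by (cases "i = j") (auto simp: rs_def diagram_hook)
    qed
    show "set rs \<subseteq> {..b + 1}"
      using bounds[of "(0, n + j)" for j] by (fastforce simp: rs_def diagram_hook)
    show "0 \<notin> set os \<or> 0 \<notin> set rs"
    proof (rule ccontr)
      assume "\<not> ?thesis"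
      then obtain j j' where j: "j < n" "u j = 0" "j' < l" "T (0, n + j') \<le> 1"
        by (force simp: os_def rs_def)
      then show False using row[of j "n + j'" 0] Tu[of j 0] by (auto simp: diagram_hook)
    qed
    show "n + count_list rs v = mu ! v + count_list os v" if "v < b + 2" for v
      using content_hook_tableau[OF \<open>length os = n\<close> \<open>length rs = l\<close> os_le, of v] card[OF that] that
      unfolding eq by simp
  qed
qed

lemma sum_parts:
  assumes "length xs = b + 1"
  shows "(\<Sum>v<b + 2. (0 # xs) ! v) = sum_list xs"
proof -
  have "sum_list (0 # xs) = (\<Sum>v<b + 2. (0 # xs) ! v)"
    using assms by (subst sum_list_sum_nth) (simp add: atLeast0LessThan)
  then show ?thesis by simp
qed

text \<open>For fixed content the extra entries alone determine the tableau, so injectivity needs only them.\<close>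

lemma hook_tableau_eqD:
  assumes "hook_tableau b os rs = hook_tableau b os' rs'"
    and "length os = length os'" and "length rs = length rs'"
  shows "rs = rs'"
proof (rule nth_equalityI)
  fix j assume "j < length rs"
  then show "rs ! j = rs' ! j"
    using fun_cong[OF assms(1), of "(0, length os + j)"] assms(2,3) by (simp add: hook_tableau_def)
qed fact

text \<open>The content fixes the difference of the two multiplicities of every value, so their minima are
  free coordinates.  Their sum is determined by the number \<open>l\<close> of extra cells; the number of omissions
  is then \<open>n\<close> because the content adds up to the number of cells.\<close>

lemma bij_betw_decode:
  assumes mu: "length mu = b + 2" "sum_list mu = n + l + n * b"
    and l: "(\<Sum>v<b + 2. mu ! v - n) + N = l"
  shows "bij_betw (decode b n mu) {xs. length xs = b + 1 \<and> sum_list xs = N}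
    (SSYT ((n + l) # replicate b n) mu)"
proof (rule bij_betw_imageI)
  let ?X = "{xs. length xs = b + 1 \<and> sum_list xs = N}"
  have "(\<Sum>v<b + 2. mu ! v) = n + l + n * b"
    using mu by (simp add: sum_list_sum_nth atLeast0LessThan)
  moreover have "(\<Sum>v<b + 2. mu ! v + (n - mu ! v)) = (\<Sum>v<b + 2. n + (mu ! v - n))"
    by (intro sum.cong) auto
  ultimately have "(\<Sum>v<b + 2. n - mu ! v) + l = n + (\<Sum>v<b + 2. mu ! v - n)"
    by (simp only: sum.distrib) simp
  then have deficit: "(\<Sum>v<b + 2. n - mu ! v) + N = n"
    using l by linarith
  have len_os: "length (blocks (omissions n mu xs) (b + 2)) = n"
    and len_rs: "length (blocks (extras n mu xs) (b + 2)) = l" if "xs \<in> ?X" for xs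
    using that l deficit sum_parts[of xs b]
    by (simp_all add: length_blocks omissions_def extras_def sum.distrib del: sum.lessThan_Suc)
  show "inj_on (decode b n mu) ?X"
  proof (rule inj_onI)
    fix xs ys assume X: "xs \<in> ?X" "ys \<in> ?X" and eq: "decode b n mu xs = decode b n mu ys"
    have "blocks (extras n mu xs) (b + 2) = blocks (extras n mu ys) (b + 2)"
      using eq unfolding decode_def
      by (rule hook_tableau_eqD) (simp_all only: length_rev len_os len_rs X)
    then have "extras n mu xs v = extras n mu ys v" if "v < b + 2" for v
      using that count_list_blocks by metis
    then have "(0 # xs) ! Suc v = (0 # ys) ! Suc v" if "v < b + 1" for v
      using that unfolding extras_def by (metis Suc_less_eq add_2_eq_Suc' add_right_cancel Suc_eq_plus1)
    then have "xs ! v = ys ! v" if "v < b + 1" for v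
      using that by (simp only: nth_Cons_Suc)
    then show "xs = ys" using X by (auto intro: nth_equalityI)
  qed
  show "decode b n mu ` ?X = SSYT ((n + l) # replicate b n) mu"
  proof (intro equalityI subsetI)
    fix T assume "T \<in> decode b n mu ` ?X"
    then obtain xs where X: "xs \<in> ?X" and T: "T = decode b n mu xs" by blast
    let ?os = "rev (blocks (omissions n mu xs) (b + 2))" and ?rs = "blocks (extras n mu xs) (b + 2)"
    show "T \<in> SSYT ((n + l) # replicate b n) mu"
      unfolding T decode_def
    proof (rule hook_tableau_in_SSYT)
      show "length ?os = n" "length ?rs = l" using X len_os len_rs by auto
      show "sorted (rev ?os)" "sorted ?rs" by (simp_all add: sorted_blocks)
      show "set ?os \<subseteq> {..b + 1}" "set ?rs \<subseteq> {..b + 1}"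
        using set_blocks[of _ "b + 2"] by fastforce+
      have "count_list (blocks (omissions n mu xs) (b + 2)) 0 = 0 \<or> count_list ?rs 0 = 0"
        by (auto simp: count_list_blocks omissions_def extras_def)
      then show "0 \<notin> set ?os \<or> 0 \<notin> set ?rs"
        by (simp add: count_list_0_iff)
      show "n + count_list ?rs v = mu ! v + count_list ?os v" if "v < b + 2" for v
        using that by (simp add: count_list_blocks omissions_def extras_def)
    qed (use mu in simp)
  next
    fix T assume "T \<in> SSYT ((n + l) # replicate b n) mu"
    then obtain os rs where T: "T = hook_tableau b os rs" and len: "length os = n" "length rs = l"
      and os: "sorted (rev os)" "set os \<subseteq> {..b + 1}"
      and rs: "sorted rs" "set rs \<subseteq> {..b + 1}"
      and corner: "0 \<notin> set os \<or> 0 \<notin> set rs"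
      and content: "\<And>v. v < b + 2 \<Longrightarrow> n + count_list rs v = mu ! v + count_list os v"
      using mu(1) by (rule SSYT_hook_tableauE) blast
    define xs where "xs = map (\<lambda>v. min (count_list os (Suc v)) (count_list rs (Suc v))) [0..<b + 1]"
    have xs: "(0 # xs) ! v = min (count_list os v) (count_list rs v)" if "v < b + 2" for v
      using that corner by (cases v) (auto simp: xs_def count_list_0_iff simp del: upt_Suc)
    have len_xs: "length xs = b + 1" by (simp add: xs_def)
    have co: "count_list os v = omissions n mu xs v" and cr: "count_list rs v = extras n mu xs v"
      if "v < b + 2" for v
      using content[OF that] xs[OF that] by (auto simp: omissions_def extras_def)
    have rs': "rs = blocks (extras n mu xs) (b + 2)"
      using rs cr by (intro sorted_eq_blocks) auto
    have os': "rev os = blocks (omissions n mu xs) (b + 2)"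
      using os co by (intro sorted_eq_blocks) auto
    have "T = decode b n mu xs"
      unfolding T decode_def rs'[symmetric] os'[symmetric] by simp
    moreover have "sum_list xs = N"
    proof -
      have "l = (\<Sum>v<b + 2. extras n mu xs v)"
        using len(2) rs' length_blocks by metis
      also have "\<dots> = sum_list xs + (\<Sum>v<b + 2. mu ! v - n)"
        using sum_parts[OF len_xs] by (simp add: extras_def sum.distrib del: sum.lessThan_Suc)
      finally show ?thesis using l by simp
    qed
    ultimately show "T \<in> decode b n mu ` ?X" using len_xs by blast
  qed
qed

text \<open>Every value occurring more than \<open>n\<close> times needs extra cells for the surplus.\<close>

lemma SSYT_hook_empty:
  assumes mu: "length mu = b + 2" and l: "l < (\<Sum>v<b + 2. mu ! v - n)"
  shows "SSYT ((n + l) # replicate b n) mu = {}"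
proof (rule ccontr)
  assume "\<not> ?thesis"
  then obtain T where "T \<in> SSYT ((n + l) # replicate b n) mu" by blast
  then obtain os rs where len: "length rs = l" and rs: "sorted rs" "set rs \<subseteq> {..b + 1}"
    and content: "\<And>v. v < b + 2 \<Longrightarrow> n + count_list rs v = mu ! v + count_list os v"
    using mu by (rule SSYT_hook_tableauE) blast
  have "(\<Sum>v<b + 2. mu ! v - n) \<le> (\<Sum>v<b + 2. count_list rs v)"
  proof (rule sum_mono)
    fix v assume "v \<in> {..<b + 2}"
    then show "mu ! v - n \<le> count_list rs v" using content[of v] by simp
  qed
  also have "\<dots> = l"
    using len rs by (subst length_eq_sum_counts[symmetric]) auto
  finally show False using l by simp
qed

section \<open>Gaussian binomials and their values at roots of unity\<close>

lemma monom_1_power: "monom (1::int) k = monom 1 1 ^ k"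
  by (simp add: monom_power)

lemma q_int_times: "q_int N * (monom 1 1 - 1) = monom 1 N - 1"
proof -
  have nz: "monom (1::int) 1 - 1 \<noteq> 0"
    by (metis degree_1 degree_monom_eq eq_iff_diff_eq_0 one_neq_zero)
  have "monom (1::int) N - 1 = (monom 1 1 - 1) * (\<Sum>i<N. monom 1 1 ^ i)"
    by (subst monom_1_power) (rule power_diff_1_eq)
  then show ?thesis
    unfolding q_int_def using nz by simp
qed

lemma q_int_add: "q_int (a + c) = q_int a + monom 1 a * q_int c"
proof -
  have nz: "monom (1::int) 1 - 1 \<noteq> 0"
    by (metis degree_1 degree_monom_eq eq_iff_diff_eq_0 one_neq_zero)
  have "q_int (a + c) * (monom 1 1 - 1) = (q_int a + monom 1 a * q_int c) * (monom 1 1 - 1)"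
  proof -
    have "(q_int a + monom 1 a * q_int c) * (monom 1 1 - 1) =
        q_int a * (monom 1 1 - 1) + monom 1 a * (q_int c * (monom 1 1 - 1))"
      by (simp only: distrib_right mult.assoc)
    then show ?thesis
      unfolding q_int_times by (simp add: right_diff_distrib mult_monom)
  qed
  then show ?thesis using nz by simp
qed

lemma q_int_nonzero: "q_int (Suc N) \<noteq> 0"
proof
  assume "q_int (Suc N) = 0"
  then have "monom (1::int) (Suc N) = 1" using q_int_times[of "Suc N"] by simp
  then show False by (metis degree_1 degree_monom_eq one_neq_zero nat.distinct(1))
qed

lemma q_fact_0: "q_fact 0 = 1"
  by (simp add: q_fact_def)

lemma q_fact_Suc: "q_fact (Suc N) = q_fact N * q_int (Suc N)"
  by (simp add: q_fact_def mult.commute)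

lemma q_fact_nonzero: "q_fact N \<noteq> 0"
  by (induction N) (auto simp: q_fact_0 q_fact_Suc q_int_nonzero)

text \<open>The Gaussian binomial with upper index \<open>r + k\<close> and lower index \<open>k\<close>, by the q-Pascal rule.
  Unlike the quotient of q-factorials, this form shows that the coefficients are nonnegative and
  can be evaluated at roots of unity.\<close>

fun gauss :: "nat \<Rightarrow> nat \<Rightarrow> int poly" where
  "gauss r 0 = 1"
| "gauss 0 (Suc k) = 1"
| "gauss (Suc r) (Suc k) = gauss r (Suc k) + monom 1 (Suc r) * gauss (Suc r) k"

lemma gauss_q_fact: "gauss r k * (q_fact k * q_fact r) = q_fact (r + k)"
proof (induction r k rule: gauss.induct)
  case (3 r k)
  have "gauss (Suc r) (Suc k) * (q_fact (Suc k) * q_fact (Suc r)) =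
      (gauss r (Suc k) * (q_fact (Suc k) * q_fact r)) * q_int (Suc r) +
      monom 1 (Suc r) * (gauss (Suc r) k * (q_fact k * q_fact (Suc r))) * q_int (Suc k)"
    by (simp add: q_fact_Suc algebra_simps)
  also have "\<dots> = q_fact (Suc r + k) * (q_int (Suc r) + monom 1 (Suc r) * q_int (Suc k))"
    using 3 by (simp add: algebra_simps)
  also have "\<dots> = q_fact (Suc r + Suc k)"
    using q_int_add[of "Suc r" "Suc k"] q_fact_Suc[of "Suc r + k"] by simp
  finally show ?case .
qed (simp_all add: q_fact_0)

lemma q_binomial_gauss: "q_binomial (int r + int k) (int k) = gauss r k"
proof -
  have "nat (int r + int k) = r + k" by linarith
  then have "q_binomial (int r + int k) (int k) = q_fact (r + k) div (q_fact k * q_fact r)"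
    by (simp add: q_binomial_def)
  also have "\<dots> = gauss r k"
    unfolding gauss_q_fact[symmetric] by (simp add: q_fact_nonzero)
  finally show ?thesis .
qed

lemma coeff_gauss_nonneg: "0 \<le> coeff (gauss r k) i"
  by (induction r k arbitrary: i rule: gauss.induct) (auto simp: coeff_monom_mult)

lemma eval_at_1: "eval_at 1 z = 1"
  by (simp add: eval_at_def)

lemma eval_at_add: "eval_at (f + g) z = eval_at f z + eval_at g z"
proof -
  have "map_poly of_int (f + g) = map_poly of_int f + (map_poly of_int g :: complex poly)"
    by (rule poly_eqI) (simp add: coeff_map_poly)
  then show ?thesis by (simp add: eval_at_def)
qed

lemma eval_at_monom_mult: "eval_at (monom 1 k * f) z = z ^ k * eval_at f z"
proof -
  have "map_poly of_int (monom 1 k * f) = monom 1 k * (map_poly of_int f :: complex poly)"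
    by (rule poly_eqI) (simp add: coeff_map_poly coeff_monom_mult)
  then show ?thesis by (simp add: eval_at_def poly_monom)
qed

definition gauss_series :: "complex \<Rightarrow> nat \<Rightarrow> complex fps" where
  "gauss_series z r = Abs_fps (\<lambda>k. eval_at (gauss r k) z)"

text \<open>The q-Pascal rule says that passing from \<open>r\<close> to \<open>r + 1\<close> divides the generating series in the
  lower index by \<open>1 - z ^ (r + 1) * X\<close>.\<close>

lemma gauss_series_product:
  "gauss_series z r * (\<Prod>i<Suc r. 1 - fps_const (z ^ i) * fps_X) = 1"
proof (induction r)
  case 0
  have "eval_at (gauss 0 k) z = 1" for k by (cases k) (simp_all add: eval_at_1)
  then show ?case
    by (simp add: gauss_series_def fps_eq_iff right_diff_distrib)
next
  case (Suc r)
  have "gauss_series z (Suc r) * (1 - fps_const (z ^ Suc r) * fps_X) = gauss_series z r"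
  proof (rule fps_ext)
    fix k
    have "fps_nth (gauss_series z (Suc r) * (1 - fps_const (z ^ Suc r) * fps_X)) k =
        eval_at (gauss (Suc r) k) z -
        fps_nth (fps_const (z ^ Suc r) * (gauss_series z (Suc r) * fps_X)) k"
      by (simp add: gauss_series_def algebra_simps)
    also have "\<dots> = fps_nth (gauss_series z r) k"
      by (cases k) (simp_all add: gauss_series_def eval_at_1 eval_at_add eval_at_monom_mult del: power_Suc)
    finally show "fps_nth (gauss_series z (Suc r) * (1 - fps_const (z ^ Suc r) * fps_X)) k =
      fps_nth (gauss_series z r) k" .
  qed
  moreover have "gauss_series z (Suc r) * (\<Prod>i<Suc (Suc r). 1 - fps_const (z ^ i) * fps_X) =
      gauss_series z (Suc r) * (1 - fps_const (z ^ Suc r) * fps_X) *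
      (\<Prod>i<Suc r. 1 - fps_const (z ^ i) * fps_X)"
    unfolding prod.lessThan_Suc[of _ "Suc r"] by (simp only: mult_ac)
  ultimately show ?case using Suc.IH by (simp only:)
qed

text \<open>Both sides have degree at most \<open>s\<close>; they agree at 0 and at the \<open>s\<close> powers of \<open>z\<close>.\<close>

lemma prod_roots_of_unity:
  assumes s: "0 < s" and z: "primitive_root_of_unity s z"
  shows "(\<Prod>i<s. [:1, - (z ^ i):]) = 1 - monom 1 s"
proof -
  let ?A = "insert 0 ((\<lambda>j. z ^ j) ` {..<s})"
  have zs: "z ^ s = 1" and min: "\<And>k. 0 < k \<Longrightarrow> k < s \<Longrightarrow> z ^ k \<noteq> 1"
    using z by (auto simp: primitive_root_of_unity_def)
  have nz: "z \<noteq> 0" using zs s by (metis power_0_left zero_neq_one not_gr0)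
  have inj: "inj_on (\<lambda>j. z ^ j) {..<s}"
  proof (rule linorder_inj_onI)
    fix i j assume "i < j" "i \<in> {..<s}" "j \<in> {..<s}"
    then have "z ^ (j - i) \<noteq> 1" using min by auto
    then show "z ^ i \<noteq> z ^ j"
      using \<open>i < j\<close> nz by (metis div_self less_imp_le power_diff power_not_zero)
  qed auto
  have card: "card ?A = Suc s"
    using nz by (subst card_insert_disjoint) (auto simp: card_image[OF inj])
  show ?thesis
  proof (rule poly_eqI_degree[of ?A])
    fix x assume "x \<in> ?A"
    then consider "x = 0" | j where "j < s" "x = z ^ j" by auto
    then show "poly (\<Prod>i<s. [:1, - (z ^ i):]) x = poly (1 - monom 1 s) x"
    proof cases
      case 1
      then show ?thesis using s by (simp add: poly_prod poly_monom)
    next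
      case (2 j)
      \<comment> \<open>The factor that vanishes at \<open>x\<close> belongs to the inverse of \<open>x\<close>.\<close>
      define i where "i = (if j = 0 then 0 else s - j)"
      have "i < s" "z ^ i * x = 1"
        using 2 s zs by (auto simp: i_def power_add[symmetric])
      then have "poly (\<Prod>i<s. [:1, - (z ^ i):]) x = 0"
        by (auto simp: poly_prod mult.commute intro!: bexI[of _ i])
      moreover have "x ^ s = 1"
        using 2 zs by (metis power_commutes power_mult power_one mult.commute)
      ultimately show ?thesis by (simp add: poly_monom)
    qed
  next
    have "degree (\<Prod>i<s. [:1, - (z ^ i):]) \<le> (\<Sum>i<s. degree [:1, - (z ^ i):])"
      using degree_prod_sum_le[of "{..<s}" "\<lambda>i. [:1, - (z ^ i):]"] by (simp add: o_def)
    also have "\<dots> \<le> (\<Sum>i<s. 1)"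
      by (rule sum_mono) simp
    finally show "degree (\<Prod>i<s. [:1, - (z ^ i):]) < card ?A" unfolding card by simp
    show "degree (1 - monom (1::complex) s) < card ?A"
      unfolding card by (intro le_less_trans[OF degree_diff_le_max]) (simp add: degree_monom_eq)
  qed
qed

text \<open>The exponents \<open>0, \<dots>, r\<close> run \<open>g\<close> times through all residues modulo \<open>s\<close>.\<close>

lemma gauss_series_root_of_unity:
  assumes s: "0 < s" and z: "primitive_root_of_unity s z" and r: "Suc r = g * s"
  shows "gauss_series z r * (1 - fps_X ^ s) ^ g = 1"
proof -
  have zs: "z ^ s = 1" using z by (simp add: primitive_root_of_unity_def)
  have "(\<Prod>i<s. 1 - fps_const (z ^ i) * fps_X) = fps_of_poly (\<Prod>i<s. [:1, - (z ^ i):])"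
    by (simp add: fps_of_poly_prod fps_of_poly_pCons fps_const_neg[symmetric] del: fps_const_neg)
  also have "\<dots> = 1 - fps_X ^ s"
    unfolding prod_roots_of_unity[OF s z] by (simp add: fps_of_poly_diff fps_of_poly_monom')
  finally have one: "(\<Prod>i<s. 1 - fps_const (z ^ i) * fps_X) = 1 - fps_X ^ s" .
  have "(\<Prod>i<Suc r. 1 - fps_const (z ^ i) * fps_X) =
      (\<Prod>a<g. \<Prod>i\<in>{a * s..<a * s + s}. 1 - fps_const (z ^ i) * fps_X)"
    unfolding r by (rule prod.nat_group[symmetric])
  also have "\<dots> = (\<Prod>a<g. \<Prod>i<s. 1 - fps_const (z ^ i) * fps_X)"
  proof (rule prod.cong[OF refl])
    fix a
    have "(\<Prod>i\<in>{a * s..<a * s + s}. 1 - fps_const (z ^ i) * fps_X) =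
        (\<Prod>i\<in>{0..<s}. 1 - fps_const (z ^ (i + a * s)) * fps_X)"
      using prod.shift_bounds_nat_ivl[of "\<lambda>i. 1 - fps_const (z ^ i) * fps_X" 0 "a * s" s]
      by (simp add: add.commute)
    moreover have "z ^ (i + a * s) = z ^ i" for i
      using zs by (simp add: power_add power_mult mult.commute[of a])
    ultimately show "(\<Prod>i\<in>{a * s..<a * s + s}. 1 - fps_const (z ^ i) * fps_X) =
        (\<Prod>i<s. 1 - fps_const (z ^ i) * fps_X)"
      by (simp add: atLeast0LessThan)
  qed
  also have "\<dots> = (1 - fps_X ^ s) ^ g"
    unfolding one by simp
  finally show ?thesis using gauss_series_product[of z r] by simp
qed

text \<open>The lists whose \<open>s\<close>-fold repetition has sum \<open>N\<close>.\<close>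

definition scaled_sum_lists :: "nat \<Rightarrow> nat \<Rightarrow> nat \<Rightarrow> nat list set" where
  "scaled_sum_lists s g N = {ys. length ys = g \<and> s * sum_list ys = N}"

lemma finite_lists_sum: "finite {xs :: nat list. length xs = r \<and> sum_list xs = N}"
proof (rule finite_subset)
  show "{xs :: nat list. length xs = r \<and> sum_list xs = N} \<subseteq> {xs. set xs \<subseteq> {..N} \<and> length xs = r}"
    using member_le_sum_list by fastforce
  show "finite {xs. set xs \<subseteq> {..N} \<and> length xs = r}"
    by (rule finite_lists_length_eq) simp
qed

lemma finite_scaled_sum_lists: "0 < s \<Longrightarrow> finite (scaled_sum_lists s g N)"
  by (rule finite_subset[OF _ finite_lists_sum[of g "N div s"]]) (auto simp: scaled_sum_lists_def)

text \<open>Either the first element is 0 and can be dropped, or it can be decreased by one.  This is the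
  recursion for the coefficients of the powers of \<open>1 / (1 - X ^ s)\<close>.\<close>

lemma card_scaled_sum_lists_Suc:
  assumes s: "0 < s"
  shows "card (scaled_sum_lists s (Suc g) N) = card (scaled_sum_lists s g N) +
    (if N < s then 0 else card (scaled_sum_lists s (Suc g) (N - s)))"
proof -
  let ?inc = "\<lambda>ys. Suc (hd ys) # tl ys"
  let ?B = "if N < s then {} else scaled_sum_lists s (Suc g) (N - s)"
  have "scaled_sum_lists s (Suc g) N = (#) 0 ` scaled_sum_lists s g N \<union> ?inc ` ?B"
    (is "?L = ?R")
  proof (rule Set.set_eqI, rule iffI)
    fix ys assume L: "ys \<in> ?L"
    then obtain y zs where ys: "ys = y # zs" by (cases ys) (auto simp: scaled_sum_lists_def)
    show "ys \<in> ?R"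
    proof (cases y)
      case 0
      then show ?thesis using L ys by (auto simp: scaled_sum_lists_def)
    next
      case (Suc x)
      then have "x # zs \<in> ?B" "ys = ?inc (x # zs)"
        using L ys by (auto simp: scaled_sum_lists_def algebra_simps)
      then show ?thesis by blast
    qed
  next
    fix ys assume "ys \<in> ?R"
    then show "ys \<in> ?L"
      by (auto simp: scaled_sum_lists_def length_Suc_conv algebra_simps split: if_splits)
  qed
  moreover have "card ((#) 0 ` scaled_sum_lists s g N \<union> ?inc ` ?B) =
      card ((#) 0 ` scaled_sum_lists s g N) + card (?inc ` ?B)"
    using finite_scaled_sum_lists[OF s] by (intro card_Un_disjoint) auto
  moreover have "inj_on ?inc ?B"
    by (rule inj_onI) (auto simp: scaled_sum_lists_def length_Suc_conv split: if_splits)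
  ultimately have "card (scaled_sum_lists s (Suc g) N) = card (scaled_sum_lists s g N) + card ?B"
    by (simp add: card_image)
  then show ?thesis by simp
qed

text \<open>The generating series of both sides over \<open>N\<close> are inverse to \<open>(1 - X ^ s) ^ g\<close>.\<close>

lemma eval_gauss_root_of_unity:
  assumes s: "0 < s" and z: "primitive_root_of_unity s z" and r: "Suc r = g * s"
  shows "eval_at (gauss r N) z = of_nat (card (scaled_sum_lists s g N))"
proof -
  define D :: "nat \<Rightarrow> complex fps" where
    "D g = Abs_fps (\<lambda>N. of_nat (card (scaled_sum_lists s g N)))" for g
  have "D g * (1 - fps_X ^ s) ^ g = 1" for g
  proof (induction g)
    case 0
    have "scaled_sum_lists s 0 N = (if N = 0 then {[]} else {})" for N
      by (auto simp: scaled_sum_lists_def)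
    then show ?case by (simp add: D_def fps_eq_iff)
  next
    case (Suc g)
    have "D (Suc g) * (1 - fps_X ^ s) = D g"
      by (rule fps_ext)
        (simp add: right_diff_distrib fps_X_power_mult_right_nth D_def card_scaled_sum_lists_Suc[OF s, of g])
    then show ?case using Suc.IH by (simp add: mult.assoc[symmetric])
  qed
  then have "D g = gauss_series z r"
    using gauss_series_root_of_unity[OF s z r] by (metis mult.assoc mult.commute mult_1)
  then show ?thesis
    by (metis D_def gauss_series_def fps_nth_Abs_fps)
qed

lemma primitive_root_power:
  assumes r: "0 < r" and w: "primitive_root_of_unity r w"
  shows "primitive_root_of_unity (r div gcd d r) (w ^ d)"
proof -
  have dvd: "r dvd k" if "w ^ k = 1" for k
  proof (rule ccontr)
    assume "\<not> r dvd k"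
    then have "0 < k mod r" "k mod r < r" using r by (auto simp: mod_greater_zero_iff_not_dvd)
    moreover have "w ^ (r * (k div r) + k mod r) = 1" using that by simp
    then have "w ^ (k mod r) = 1"
      using w by (simp only: power_add power_mult primitive_root_of_unity_def) simp
    ultimately show False using w by (auto simp: primitive_root_of_unity_def)
  qed
  let ?g = "gcd d r"
  have g: "0 < ?g" using r by simp
  have "d * (r div ?g) = r * (d div ?g)"
    by (metis div_mult_swap dvd_div_mult gcd_dvd1 gcd_dvd2 mult.commute)
  then have "(w ^ d) ^ (r div ?g) = 1"
    using w by (metis power_mult power_one primitive_root_of_unity_def)
  moreover have "(w ^ d) ^ k \<noteq> 1" if "0 < k" "k < r div ?g" for k
  proof
    assume "(w ^ d) ^ k = 1"
    then have "r dvd d * k" using dvd by (simp add: power_mult)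
    moreover have "d * k = (d div ?g) * k * ?g"
      by (metis dvd_div_mult_self gcd_dvd1 mult.assoc mult.commute)
    moreover have "r = (r div ?g) * ?g" by simp
    ultimately have "(r div ?g) * ?g dvd (d div ?g) * k * ?g" by metis
    then have "r div ?g dvd (d div ?g) * k" using g by (metis dvd_times_right_cancel_iff less_irrefl)
    moreover have "coprime (r div ?g) (d div ?g)"
      using r by (simp add: div_gcd_coprime coprime_commute)
    ultimately have "r div ?g dvd k" by (simp add: coprime_dvd_mult_right_iff)
    then show False using that by (auto dest: dvd_imp_le)
  qed
  ultimately show ?thesis by (simp add: primitive_root_of_unity_def)
qed

section \<open>Lists fixed by a rotation\<close>

lemma rotate_multiple:
  "rotate g xs = xs \<Longrightarrow> rotate (t * g) xs = xs"
  by (induction t) (simp_all add: rotate_rotate[symmetric])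

text \<open>By Bezout, the gcd is a multiple of \<open>d\<close> modulo the length.\<close>

lemma rotate_gcd: "rotate d xs = xs \<longleftrightarrow> rotate (gcd d (length xs)) xs = xs"
proof
  assume fixed: "rotate d xs = xs"
  show "rotate (gcd d (length xs)) xs = xs"
  proof (cases "d = 0")
    case False
    then obtain x y where xy: "d * x = length xs * y + gcd d (length xs)"
      using bezout_nat by blast
    have "xs = rotate (d * x) xs" using rotate_multiple[OF fixed, of x] by (simp add: mult.commute)
    also have "\<dots> = rotate (gcd d (length xs)) xs"
      by (subst rotate_conv_mod) (simp add: xy rotate_conv_mod[symmetric])
    finally show ?thesis by simp
  qed simp
next
  assume "rotate (gcd d (length xs)) xs = xs"
  then show "rotate d xs = xs"
    using rotate_multiple[of "gcd d (length xs)" xs "d div gcd d (length xs)"] by simp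
qed

definition repeat_list :: "nat \<Rightarrow> nat list \<Rightarrow> nat list" where
  "repeat_list s ys = map (\<lambda>i. ys ! (i mod length ys)) [0..<s * length ys]"

lemma sum_repeat_list: "sum_list (repeat_list s ys) = s * sum_list ys"
proof -
  let ?g = "length ys"
  have "sum_list (repeat_list s ys) = (\<Sum>i<s * ?g. ys ! (i mod ?g))"
    by (simp add: repeat_list_def interv_sum_list_conv_sum_set_nat atLeast0LessThan)
  also have "\<dots> = (\<Sum>a<s. \<Sum>i\<in>{a * ?g..<a * ?g + ?g}. ys ! (i mod ?g))"
    by (rule sum.nat_group[symmetric])
  also have "\<dots> = (\<Sum>a<s. \<Sum>i<?g. ys ! i)"
  proof (rule sum.cong[OF refl])
    fix a
    show "(\<Sum>i\<in>{a * ?g..<a * ?g + ?g}. ys ! (i mod ?g)) = (\<Sum>i<?g. ys ! i)"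
      using sum.shift_bounds_nat_ivl[of "\<lambda>i. ys ! (i mod ?g)" 0 "a * ?g" ?g]
      by (simp add: add.commute atLeast0LessThan)
  qed
  finally show ?thesis by (simp add: sum_list_sum_nth atLeast0LessThan)
qed

text \<open>A list that agrees with its rotation by \<open>g\<close> has \<open>xs ! (i + g) = xs ! i\<close>, so it is determined by
  its first \<open>g\<close> elements.\<close>

lemma rotate_fixed_iff_repeat:
  assumes g: "0 < g" and len: "length xs = s * g"
  shows "rotate g xs = xs \<longleftrightarrow> (\<exists>ys. length ys = g \<and> xs = repeat_list s ys)"
proof
  assume fixed: "rotate g xs = xs"
  have step: "xs ! (i + g) = xs ! i" if "i + g < length xs" for i
    using that nth_rotate[of i xs g] fixed by (simp add: add.commute)
  have "xs ! i = xs ! (i mod g)" if "i < length xs" for i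
    using that
  proof (induction i rule: less_induct)
    case (less i)
    show ?case
    proof (cases "i < g")
      case False
      then show ?thesis
        using less.IH[of "i - g"] less.prems step[of "i - g"] g by (simp add: le_mod_geq)
    qed simp
  qed
  moreover have "length (take g xs) = g" if "0 < s"
    using that len by simp
  ultimately have "xs = repeat_list s (take g xs)" if "0 < s"
    using that g len by (intro nth_equalityI) (auto simp: repeat_list_def simp del: length_take)
  moreover have "xs = repeat_list s (replicate g 0)" if "s = 0"
    using that len by (simp add: repeat_list_def)
  ultimately show "\<exists>ys. length ys = g \<and> xs = repeat_list s ys"
    using \<open>0 < s \<Longrightarrow> length (take g xs) = g\<close> by (metis length_replicate not_gr0)
next
  assume "\<exists>ys. length ys = g \<and> xs = repeat_list s ys"
  then obtain ys where ys: "length ys = g" "xs = repeat_list s ys" by blast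
  show "rotate g xs = xs"
  proof (rule nth_equalityI)
    fix i assume "i < length (rotate g xs)"
    then have i: "i < s * g" using len by simp
    then have "(g + i) mod (s * g) < s * g" using i by (intro mod_less_divisor) linarith
    then show "rotate g xs ! i = xs ! i"
      using i ys len g by (simp add: nth_rotate repeat_list_def mod_mod_cancel)
  qed simp
qed

lemma card_rotation_fixed:
  assumes r: "0 < r"
  shows "card {xs. length xs = r \<and> sum_list xs = N \<and> rotate d xs = xs} =
    card (scaled_sum_lists (r div gcd d r) (gcd d r) N)"
proof -
  let ?g = "gcd d r" and ?s = "r div gcd d r"
  have g: "0 < ?g" and s: "0 < ?s" and rgs: "r = ?s * ?g"
    using r by (auto simp: div_greater_zero_iff dvd_imp_le)
  have "{xs. length xs = r \<and> sum_list xs = N \<and> rotate d xs = xs} =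
      repeat_list ?s ` scaled_sum_lists ?s ?g N" (is "?L = ?R")
  proof (rule Set.set_eqI, rule iffI)
    fix xs assume L: "xs \<in> ?L"
    then have "rotate ?g xs = xs" using rotate_gcd[of d xs] by auto
    then obtain ys where "length ys = ?g" "xs = repeat_list ?s ys"
      using rotate_fixed_iff_repeat[OF g, of xs ?s] L rgs by auto
    then show "xs \<in> ?R"
      using L by (auto simp: scaled_sum_lists_def sum_repeat_list)
  next
    fix xs assume "xs \<in> ?R"
    then obtain ys where ys: "length ys = ?g" "?s * sum_list ys = N" "xs = repeat_list ?s ys"
      by (auto simp: scaled_sum_lists_def)
    have len: "length xs = r" using ys rgs by (simp add: repeat_list_def)
    then have "rotate ?g xs = xs"
      using rotate_fixed_iff_repeat[OF g, of xs ?s] ys rgs by auto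
    then show "xs \<in> ?L"
      using len ys rotate_gcd[of d xs] by (simp add: sum_repeat_list)
  qed
  moreover have "inj_on (repeat_list ?s) (scaled_sum_lists ?s ?g N)"
  proof (rule inj_onI)
    fix ys zs assume len: "ys \<in> scaled_sum_lists ?s ?g N" "zs \<in> scaled_sum_lists ?s ?g N"
      and eq: "repeat_list ?s ys = repeat_list ?s zs"
    have nth: "repeat_list ?s us ! i = us ! i" if "i < ?g" "length us = ?g" for us i
    proof -
      have "i < ?s * ?g" using that s by (metis less_le_trans mult_le_mono1 mult_1 Suc_leI One_nat_def)
      then show ?thesis using that by (simp add: repeat_list_def)
    qed
    have "ys ! i = zs ! i" if "i < ?g" for i
      using nth[OF that, of ys] nth[OF that, of zs] eq len by (simp add: scaled_sum_lists_def)
    then show "ys = zs"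
      using len by (intro nth_equalityI) (auto simp: scaled_sum_lists_def)
  qed
  ultimately show ?thesis by (simp add: card_image)
qed

text \<open>The lists fixed by \<open>rotate d\<close> repeat a list of length \<open>gcd d (r + 1)\<close>, and the number
  of repetitions is the order of \<open>w ^ d\<close>; so both sides come from the same generating series.\<close>

lemma gauss_sieving:
  assumes "primitive_root_of_unity (Suc r) w"
  shows "of_nat (card {xs. length xs = Suc r \<and> sum_list xs = N \<and> rotate d xs = xs}) =
    eval_at (gauss r N) (w ^ d)"
proof -
  let ?g = "gcd d (Suc r)" and ?s = "Suc r div gcd d (Suc r)"
  have "0 < ?s" "Suc r = ?g * ?s"
    by (auto simp: div_greater_zero_iff dvd_imp_le)
  then show ?thesis
    using eval_gauss_root_of_unity[of ?s "w ^ d" r ?g N] primitive_root_power[OF _ assms]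
    by (simp add: card_rotation_fixed)
qed

section \<open>Promotion as a cyclic action\<close>

lemma sum_list_rotate: "sum_list (rotate t xs) = sum_list (xs :: nat list)"
proof (induction t)
  case (Suc t)
  have "sum_list (rotate1 ys) = sum_list ys" for ys :: "nat list" by (cases ys) auto
  then show ?case using Suc by simp
qed simp

text \<open>A map whose \<open>r\<close>-th iterate is the identity on \<open>X\<close> permutes \<open>X\<close>, its inverse
  being the \<open>(r - 1)\<close>-th iterate.\<close>

lemma iterates_group_action:
  assumes r: "0 < r" and maps: "\<And>x. x \<in> X \<Longrightarrow> f x \<in> X" and period: "\<And>x. x \<in> X \<Longrightarrow> (f ^^ r) x = x"
  shows "group_action (integer_mod_group r) X (\<lambda>z. \<lambda>x\<in>X. (f ^^ nat z) x)"
proof -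
  have "bij_betw f X X"
  proof (rule bij_betw_byWitness[where f' = "f ^^ (r - 1)"])
    have "f ^^ (r - 1) \<circ> f = f ^^ r" "f \<circ> f ^^ (r - 1) = f ^^ r"
      using r funpow_Suc_right[of "r - 1" f] funpow.simps(2)[of "r - 1" f] by simp_all
    then have eqs: "(f ^^ (r - 1)) (f x) = (f ^^ r) x" "f ((f ^^ (r - 1)) x) = (f ^^ r) x" for x
      by (metis comp_apply)+
    show "\<forall>x\<in>X. (f ^^ (r - 1)) (f x) = x" "\<forall>x\<in>X. f ((f ^^ (r - 1)) x) = x"
      using period eqs by auto
    have "(f ^^ j) x \<in> X" if "x \<in> X" for x j
      using that maps by (induction j) auto
    then show "(f ^^ (r - 1)) ` X \<subseteq> X" "f ` X \<subseteq> X" using maps by blast+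
  qed
  then have bij: "bij_betw (f ^^ j) X X" for j
    by (rule bij_betw_funpow)
  have Bij: "(\<lambda>x\<in>X. (f ^^ j) x) \<in> Bij X" for j
    unfolding Bij_def using bij[of j] by (simp cong: bij_betw_cong)
  show ?thesis
    unfolding group_action_def group_hom_def group_hom_axioms_def
  proof (intro conjI group_integer_mod_group group_BijGroup homI)
    fix x show "(\<lambda>y\<in>X. (f ^^ nat x) y) \<in> carrier (BijGroup X)"
      using Bij by (simp add: BijGroup_def)
  next
    fix x y assume xy: "x \<in> carrier (integer_mod_group r)" "y \<in> carrier (integer_mod_group r)"
    then have nat: "nat ((x + y) mod int r) = (nat x + nat y) mod r"
      using r by (simp add: carrier_integer_mod_group nat_mod_distrib nat_add_distrib)
    have "(f ^^ nat ((x + y) mod int r)) u = (f ^^ nat x) ((f ^^ nat y) u)" if "u \<in> X" for u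
      using period[OF that] by (simp add: nat funpow_mod_eq funpow_add)
    moreover have "(f ^^ nat y) u \<in> X" if "u \<in> X" for u
      using bij[of "nat y"] that by (meson bij_betwE)
    ultimately show "(\<lambda>u\<in>X. (f ^^ nat (x \<otimes>\<^bsub>integer_mod_group r\<^esub> y)) u) =
        (\<lambda>u\<in>X. (f ^^ nat x) u) \<otimes>\<^bsub>BijGroup X\<^esub> (\<lambda>u\<in>X. (f ^^ nat y) u)"
      using Bij by (auto simp: BijGroup_def compose_def fun_eq_iff restrict_def)
  qed
qed

lemma integer_mod_group_generated_by_1:
  assumes "1 < r"
  shows "subgroup_generated (integer_mod_group r) {1} = integer_mod_group r"
proof -
  interpret group "integer_mod_group r" by simp
  have one: "1 \<in> carrier (integer_mod_group r)" using assms by simp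
  have "generate (integer_mod_group r) {1} = {k mod int r | k. True}"
    using generate_pow[OF one] by (simp add: int_pow_integer_mod_group)
  also have "\<dots> = carrier (integer_mod_group r)"
    using assms by (auto simp: carrier_integer_mod_group) (metis mod_pos_pos_trivial)
  finally show ?thesis
    using one by (simp add: subgroup_generated_def)
qed

lemma cyclic_sieving_iterates:
  assumes r: "1 < r" and fin: "finite X" and maps: "\<And>x. x \<in> X \<Longrightarrow> f x \<in> X"
    and period: "\<And>x. x \<in> X \<Longrightarrow> (f ^^ r) x = x"
    and coeff: "\<And>i. 0 \<le> coeff p i"
    and fixed: "\<And>d w. primitive_root_of_unity r w \<Longrightarrow>
      of_nat (card {x \<in> X. (f ^^ d) x = x}) = eval_at p (w ^ d)"
  shows "cyclic_sieving (integer_mod_group r) X (\<lambda>z. \<lambda>x\<in>X. (f ^^ nat z) x) 1 p"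
proof -
  have card: "card (carrier (integer_mod_group r)) = r" and fin_c: "finite (carrier (integer_mod_group r))"
    using r by (auto simp: carrier_integer_mod_group)
  have "{x \<in> X. (\<lambda>x\<in>X. (f ^^ nat (1 [^]\<^bsub>integer_mod_group r\<^esub> d)) x) x = x} = {x \<in> X. (f ^^ d) x = x}" for d :: nat
    using period by (auto simp: zmod_int[symmetric] funpow_mod_eq)
  then show ?thesis
    unfolding cyclic_sieving_def
    using iterates_group_action[of r X f] integer_mod_group_generated_by_1[OF r] assms card fin_c by auto
qed

theorem theorem4p8:
  fixes m n b :: nat and mu :: "nat list"
  assumes "0 < m" and "0 < n" and "0 < b" and "n \<le> m"
    and "length mu = b + 2"
    and "sum_list mu = m + n * b"
  shows "cyclic_sieving (integer_mod_group (b + 1)) (SSYT (m # replicate b n) mu)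
           (promotion_action (b + 2) (SSYT (m # replicate b n) mu)) 1
           (q_binomial (int b + beta m n mu) (beta m n mu))
       \<and> (\<forall>(d::nat) \<omega>. primitive_root_of_unity (b + 1) \<omega> \<longrightarrow>
            of_nat (card {T \<in> SSYT (m # replicate b n) mu.
                            (promotion (b + 2) ^^ ((b + 2) * d)) T = T})
              = eval_at (q_binomial (int b + beta m n mu) (beta m n mu)) (\<omega> ^ d))"
proof -
  let ?X = "SSYT (m # replicate b n) mu" and ?f = "q_binomial (int b + beta m n mu) (beta m n mu)"
  define g where "g = promotion (b + 2) ^^ (b + 2)"
  let ?surplus = "\<Sum>v<b + 2. mu ! v - n"
  define l where "l = m - n"
  have m: "m = n + l" using \<open>n \<le> m\<close> by (simp add: l_def)
  have "(if mu ! v > n then int (mu ! v) - int n else 0) = int (mu ! v - n)" for v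
    by auto
  then have beta: "beta m n mu = int l - int ?surplus"
    using assms(5) m unfolding beta_def by simp
  have power: "(g ^^ d) T = (promotion (b + 2) ^^ ((b + 2) * d)) T" for d T
    by (simp only: g_def funpow_mult)
  have "finite ?X \<and> (\<forall>T\<in>?X. g T \<in> ?X \<and> (g ^^ (b + 1)) T = T) \<and> (\<forall>i. 0 \<le> coeff ?f i) \<and>
    (\<forall>d w. primitive_root_of_unity (b + 1) w \<longrightarrow>
      of_nat (card {T \<in> ?X. (g ^^ d) T = T}) = eval_at ?f (w ^ d))"
  proof (cases "?surplus \<le> l")
    case False
    \<comment> \<open>Here \<open>beta\<close> is negative, and both sides of the sieving identity vanish.\<close>
    then have "?X = {}"
      using SSYT_hook_empty[OF assms(5), of l n] m by simp
    moreover have "int l < int ?surplus" using False by (simp only: of_nat_less_iff not_le)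
    then have "beta m n mu < 0" unfolding beta by (simp only: diff_less_0_iff_less)
    then have "?f = 0" by (simp add: q_binomial_def)
    ultimately show ?thesis by (simp add: eval_at_def)
  next
    case True
    define N where "N = l - ?surplus"
    let ?Y = "{xs. length xs = b + 1 \<and> sum_list xs = N}"
    have dec: "bij_betw (decode b n mu) ?Y ?X"
      unfolding m using assms(5,6) m True by (intro bij_betw_decode) (simp_all add: N_def)
    have "beta m n mu = int N" using True beta by (simp add: N_def)
    then have f: "?f = gauss b N" using q_binomial_gauss[of b N] by simp
    have turn: "(g ^^ d) (decode b n mu xs) = decode b n mu (rotate ((b + 2) * d * b) xs)"
      if "xs \<in> ?Y" for d xs
      unfolding power using promotion_full_turns[OF assms(3,5)] that by simp
    have rot: "rotate t xs \<in> ?Y" if "xs \<in> ?Y" for t xs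
      using that by (auto simp: sum_list_rotate)
    have X: "T \<in> ?X \<Longrightarrow> \<exists>xs\<in>?Y. T = decode b n mu xs" for T
      using dec by (auto simp: bij_betw_def)
    have mem: "xs \<in> ?Y \<Longrightarrow> decode b n mu xs \<in> ?X" for xs
      using dec by (auto simp: bij_betw_def)
    have "g T \<in> ?X \<and> (g ^^ (b + 1)) T = T" if T: "T \<in> ?X" for T
    proof -
      obtain xs where xs: "xs \<in> ?Y" "T = decode b n mu xs" using X[OF T] by blast
      have "rotate ((b + 2) * (b + 1) * b) xs = xs"
        using xs by (intro rotate_id) (metis (mono_tags) mem_Collect_eq mod_mult_self1_is_0 mult.assoc mult.commute)
      moreover have "g T = (g ^^ 1) T" by (simp only: One_nat_def funpow.simps comp_id)
      ultimately show ?thesis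
        using turn[OF xs(1), of 1] turn[OF xs(1), of "b + 1"] rot[OF xs(1)] mem xs(2) by metis
    qed
    moreover have "of_nat (card {T \<in> ?X. (g ^^ d) T = T}) = eval_at ?f (w ^ d)"
      if w: "primitive_root_of_unity (b + 1) w" for d w
    proof -
      \<comment> \<open>Modulo \<open>b + 1\<close> the factor \<open>(b + 2) * b\<close> is \<open>-1\<close>: a full turn of promotions rotates
        the coordinates by one step to the right, and both orientations have the same fixed points.\<close>
      have "coprime ((b + 2) * b) (b + 1)"
        using coprime_Suc_left_nat[of "b + 1"] coprime_Suc_right_nat[of b]
        unfolding coprime_mult_left_iff by simp
      then have "gcd ((b + 2) * b * d) (b + 1) = gcd d (b + 1)"
        by (subst (asm) coprime_commute) (rule gcd_mult_left_left_cancel)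
      moreover have "(b + 2) * d * b = (b + 2) * b * d" by (simp only: mult_ac)
      ultimately have gcd: "gcd ((b + 2) * d * b) (b + 1) = gcd d (b + 1)" by (simp only:)
      have inv: "decode b n mu (rotate t xs) = decode b n mu xs \<longleftrightarrow> rotate t xs = xs" if "xs \<in> ?Y" for xs t
        using inj_on_eq_iff[OF bij_betw_imp_inj_on[OF dec] rot[OF that] that] .
      have "{T \<in> ?X. (g ^^ d) T = T} = decode b n mu ` {xs \<in> ?Y. rotate ((b + 2) * d * b) xs = xs}"
      proof (intro equalityI subsetI)
        fix T assume T: "T \<in> {T \<in> ?X. (g ^^ d) T = T}"
        then obtain xs where "xs \<in> ?Y" "T = decode b n mu xs" using X by blast
        then show "T \<in> decode b n mu ` {xs \<in> ?Y. rotate ((b + 2) * d * b) xs = xs}"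
          using T turn inv by auto
      next
        fix T assume "T \<in> decode b n mu ` {xs \<in> ?Y. rotate ((b + 2) * d * b) xs = xs}"
        then obtain xs where "xs \<in> ?Y" "rotate ((b + 2) * d * b) xs = xs" "T = decode b n mu xs"
          by blast
        then show "T \<in> {T \<in> ?X. (g ^^ d) T = T}" using turn mem by simp
      qed
      also have "{xs \<in> ?Y. rotate ((b + 2) * d * b) xs = xs} =
          {xs. length xs = Suc b \<and> sum_list xs = N \<and> rotate d xs = xs}"
      proof -
        have "rotate ((b + 2) * d * b) xs = xs \<longleftrightarrow> rotate d xs = xs" if "length xs = b + 1" for xs :: "nat list"
          using rotate_gcd[of "(b + 2) * d * b" xs] rotate_gcd[of d xs] gcd unfolding that by simp
        then show ?thesis unfolding Suc_eq_plus1 by blast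
      qed
      finally have "{T \<in> ?X. (g ^^ d) T = T} =
          decode b n mu ` {xs. length xs = Suc b \<and> sum_list xs = N \<and> rotate d xs = xs}" .
      moreover have "inj_on (decode b n mu) {xs. length xs = Suc b \<and> sum_list xs = N \<and> rotate d xs = xs}"
        by (rule inj_on_subset[OF bij_betw_imp_inj_on[OF dec]]) auto
      ultimately have "card {T \<in> ?X. (g ^^ d) T = T} =
          card {xs. length xs = Suc b \<and> sum_list xs = N \<and> rotate d xs = xs}"
        by (simp only: card_image)
      then show ?thesis
        using gauss_sieving[of b w N d] w f by simp
    qed
    ultimately show ?thesis
      using bij_betw_finite[OF dec] finite_lists_sum f coeff_gauss_nonneg by simp
  qed
  then have "finite ?X" and maps: "\<And>T. T \<in> ?X \<Longrightarrow> g T \<in> ?X" and per: "\<And>T. T \<in> ?X \<Longrightarrow> (g ^^ (b + 1)) T = T"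
    and coeff: "\<And>i. 0 \<le> coeff ?f i"
    and fixed: "\<And>d w. primitive_root_of_unity (b + 1) w \<Longrightarrow>
      of_nat (card {T \<in> ?X. (g ^^ d) T = T}) = eval_at ?f (w ^ d)"
    by blast+
  have "cyclic_sieving (integer_mod_group (b + 1)) ?X (promotion_action (b + 2) ?X) 1 ?f"
    unfolding promotion_action_def g_def[symmetric]
    using assms(3) by (intro cyclic_sieving_iterates maps per coeff fixed \<open>finite ?X\<close>) auto
  then show ?thesis
    using fixed unfolding power by blast
qed

end
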